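(* Let $p$ be a prime with $p\equiv \pm 29 \bmod 120$. The group $\mathrm{SL}_2(\mathbf{F}_p)$ contains a pair of nonconjugate solvably equivalent subgroups $H_1, H_2$ whose projective images (their images in $\mathrm{PSL}_2(\mathbf{F}_p)=\mathrm{SL}_2(\mathbf{F}_p)/\{\pm1\}$) are nonconjugate solvably equivalent subgroups of $\mathrm{PSL}_2(\mathbf{F}_p)$ isomorphic to the alternating group $A_5$.
   Context: For a finite group $G$ and a subgroup $H\le G$, $[H\backslash G]$ denotes the set of right cosets of $H$ in $G$ with the right action of $G$, and for $K\le G$ put $\chi_H(K)=\#[H\backslash G]^K$, the number of right cosets of $H$ fixed by every element of $K$. Subgroups $H_1,H_2$ of a finite group $G$ are solvably equivalent (in $G$) if they satisfy the following equivalent properties: (i) there is a bijection between the set of solvable subgroups of $H_1$ and the set of solvable subgroups of $H_2$ that sends each subgroup to a $G$-conjugate of itself; (ii) $\chi_{H_1}(K)=\chi_{H_2}(K)$ for every solvable $K\le G$; (iii) $[H_1\backslash G]$ and $[H_2\backslash G]$ are isomorphic as $K$-sets for every solvable $K\le G$. "Nonconjugate" means nonconjugate in the ambient group ($\mathrm{SL}_2(\mathbf{F}_p)$ or $\mathrm{PSL}_2(\mathbf{F}_p)$, respectively). *)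

theory Defs
  imports "HOL-Analysis.Determinants" "HOL-Algebra.Solvable_Groups" "HOL-Algebra.Sym_Groups"
    "HOL-Number_Theory.Cong"
begin

definition SL2 :: "('k::field ^ 2 ^ 2) monoid" where
  "SL2 = \<lparr>carrier = {A. det A = 1}, mult = (**), one = mat 1\<rparr>"

definition SL2_pm1 :: "('k::field ^ 2 ^ 2) set" where
  "SL2_pm1 = {mat 1, - mat 1}"

definition PSL2 :: "('k::field ^ 2 ^ 2) set monoid" where
  "PSL2 = SL2 Mod SL2_pm1"

definition projective_image :: "('k::field ^ 2 ^ 2) set \<Rightarrow> ('k ^ 2 ^ 2) set set" where
  "projective_image H = (\<lambda>A. SL2_pm1 #>\<^bsub>SL2\<^esub> A) ` H"

definition conjugate_in :: "('a, 'b) monoid_scheme \<Rightarrow> 'a set \<Rightarrow> 'a set \<Rightarrow> bool" where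
  "conjugate_in G H K \<longleftrightarrow> (\<exists>g\<in>carrier G. K = (\<lambda>h. g \<otimes>\<^bsub>G\<^esub> h \<otimes>\<^bsub>G\<^esub> inv\<^bsub>G\<^esub> g) ` H)"

definition solvable_subgroups :: "('a, 'b) monoid_scheme \<Rightarrow> 'a set \<Rightarrow> 'a set set" where
  "solvable_subgroups G H = {K. subgroup K (G\<lparr>carrier := H\<rparr>) \<and> solvable (G\<lparr>carrier := K\<rparr>)}"

text \<open>
  For finite \<open>G\<close> the condition below is equivalent to \<open>H1\<close> and \<open>H2\<close> having, for every solvable
  subgroup \<open>K\<close> of \<open>G\<close>, isomorphic \<open>K\<close>-sets of right cosets, and also to their having equal
  numbers of \<open>K\<close>-fixed right cosets. It is meant for subgroups \<open>H1\<close>, \<open>H2\<close> of a finite group \<open>G\<close>;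
  conjugacy is taken in \<open>G\<close>, not in \<open>H1\<close> or \<open>H2\<close>.
\<close>

definition solvably_equivalent :: "('a, 'b) monoid_scheme \<Rightarrow> 'a set \<Rightarrow> 'a set \<Rightarrow> bool" where
  "solvably_equivalent G H1 H2 \<longleftrightarrow>
     (\<exists>f. bij_betw f (solvable_subgroups G H1) (solvable_subgroups G H2) \<and>
          (\<forall>K\<in>solvable_subgroups G H1. conjugate_in G K (f K)))"

lemma group_SL2: "group (SL2 :: ('k::field ^ 2 ^ 2) monoid)"
proof (rule groupI)
  fix A :: "'k ^ 2 ^ 2" assume "A \<in> carrier SL2"
  then have A: "det A = 1" by (simp add: SL2_def)
  then have "invertible A" by (simp add: invertible_det_nz)
  then obtain B where B: "B ** A = mat 1" by (auto simp: invertible_def)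
  have "det B * det A = 1" by (metis B det_mul det_I)
  with A B show "\<exists>B\<in>carrier SL2. B \<otimes>\<^bsub>SL2\<^esub> A = \<one>\<^bsub>SL2\<^esub>"
    by (auto simp: SL2_def)
qed (auto simp: SL2_def det_mul matrix_mul_assoc)

lemma normal_SL2_pm1: "SL2_pm1 \<lhd> (SL2 :: ('k::field ^ 2 ^ 2) monoid)"
proof -
  interpret group "SL2 :: ('k ^ 2 ^ 2) monoid" by (rule group_SL2)
  have neg: "- A ** B = - (A ** B)" "A ** - B = - (A ** B)" for A B :: "'k ^ 2 ^ 2"
    by (simp_all add: matrix_matrix_mult_def vec_eq_iff sum_negf)
  have det: "det (- mat 1 :: 'k ^ 2 ^ 2) = 1"
    by (simp add: det_2 mat_def)
  have inv_neg: "inv\<^bsub>SL2\<^esub> (- mat 1 :: 'k ^ 2 ^ 2) = - mat 1"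
    by (rule inv_equality) (auto simp: SL2_def det neg)
  have inv_one: "inv\<^bsub>SL2\<^esub> (mat 1 :: 'k ^ 2 ^ 2) = mat 1"
    by (rule inv_equality) (auto simp: SL2_def)
  have sub: "subgroup SL2_pm1 (SL2 :: ('k ^ 2 ^ 2) monoid)"
    by (rule subgroupI)
       (auto simp: SL2_pm1_def inv_neg inv_one, auto simp: SL2_def det neg)
  show ?thesis
  proof (rule normal_invI[OF sub])
    fix x h :: "'k ^ 2 ^ 2" assume x: "x \<in> carrier SL2" and h: "h \<in> SL2_pm1"
    have "x \<otimes>\<^bsub>SL2\<^esub> h = h \<otimes>\<^bsub>SL2\<^esub> x"
      using h by (auto simp: SL2_pm1_def SL2_def neg)
    then have "x \<otimes>\<^bsub>SL2\<^esub> h \<otimes>\<^bsub>SL2\<^esub> inv\<^bsub>SL2\<^esub> x = h"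
      using x h subgroup.mem_carrier[OF sub] by (simp add: m_assoc)
    with h show "x \<otimes>\<^bsub>SL2\<^esub> h \<otimes>\<^bsub>SL2\<^esub> inv\<^bsub>SL2\<^esub> x \<in> SL2_pm1" by simp
  qed
qed

lemma group_PSL2: "group (PSL2 :: ('k::field ^ 2 ^ 2) set monoid)"
  unfolding PSL2_def by (rule normal.factorgroup_is_group[OF normal_SL2_pm1])

end

theory Submission
  imports "HOL-Algebra.Algebraic_Closure_Type" "HOL-Number_Theory.Residues" Defs
begin

text \<open>
  Let \<open>H\<close> be the binary icosahedral group, realised by unit quaternions over the field with \<open>p\<close>
  elements, and let \<open>H'\<close> be its conjugate by an element \<open>g\<close> of \<open>GL2\<close> of nonsquare determinant. A subgroup
  \<open>K\<close> is conjugate to \<open>g K g\<^sup>-\<^sup>1\<close> in \<open>SL2\<close> as soon as some element of nonsquare determinant normalizes \<open>K\<close>. No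
  such element normalizes \<open>H\<close>, so \<open>H\<close> and \<open>H'\<close> are not conjugate. A solvable \<open>K\<close> contained in \<open>H\<close>
  has a noncentral normal subgroup \<open>L\<close> whose commutators are \<open>\<plusminus>1\<close>. If \<open>L\<close> is abelian and \<open>a\<close> is
  a noncentral element of \<open>L\<close>, then \<open>1 + a\<close> and \<open>1 - a\<close> normalize \<open>K\<close>, up to the centre; their determinants
  are \<open>2 \<plusminus> tr a\<close>, and one of these is among \<open>2\<close>, \<open>3\<close>, \<open>2 + \<phi>\<close>, \<open>3 - \<phi>\<close> with \<open>\<phi>\<close> the golden ratio.
  Otherwise \<open>L\<close> is a quaternion group, and \<open>1 + i\<close> works for a suitable \<open>i\<close> in \<open>L\<close>. The
  congruence on \<open>p\<close> says that \<open>\<phi>\<close> exists and that these four determinants are not squares.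

  The identification with \<open>A5\<close> comes from the action of \<open>H\<close> on the five orthogonal frames of an
  icosahedron.
\<close>

section \<open>Squares in prime fields\<close>

text \<open>The subgroups of A5 are never classified. Their place is taken by the last nontrivial
  derived term of the projective image of \<open>K\<close>. In \<open>K\<close> itself that term may
  be just the centre, as for a quaternion group, and then says nothing; this is why commutators are
  controlled only up to sign. The four determinants arise because \<open>1 + e * a\<close> has norm
  \<open>2 + e * tr a\<close> for a sign \<open>e\<close>, and a noncentral element has trace 0,
  \<plusminus>1, \<plusminus>\<phi> or \<plusminus>(\<phi> - 1). Each of the four is the square of a
  sum \<open>z + 1/z\<close>, with \<open>z\<close> a root of unity of order 8, 12 or 20, while
  \<phi> itself is such a sum for order 10. The Frobenius map replaces \<open>z\<close> by its
  \<open>p\<close>-th power, so the residues of \<open>p\<close> modulo 8, 12 and 20 make it negate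
  the former sums and the residue modulo 10 makes it fix the latter.\<close>

lemma CHAR_prime_card:
  assumes "prime p" "card (UNIV :: 'k::{field,finite} set) = p"
  shows "CHAR('k) = p"
  using CHAR_dvd_CARD[where 'a = 'k] CHAR_not_1[where 'a = 'k] assms
  by (metis One_nat_def prime_nat_iff)

text \<open>A field of prime order consists of multiples of 1, and the Frobenius map is additive and
  fixes 1.\<close>

lemma power_prime_card_eq_same:
  fixes x :: "'k::{field,finite}"
  assumes p: "prime p" "card (UNIV :: 'k set) = p"
  shows "x ^ p = x"
proof -
  have c: "CHAR('k) = p" by (rule CHAR_prime_card[OF p])
  have "inj_on (of_nat :: nat \<Rightarrow> 'k) {..<p}"
    by (auto simp: inj_on_def of_nat_eq_iff_cong_CHAR c cong_def)
  then have "card (of_nat ` {..<p} :: 'k set) = p" by (simp add: card_image)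
  then have "of_nat ` {..<p} = (UNIV :: 'k set)" using p(2) by (intro card_subset_eq) auto
  then obtain n where x: "x = of_nat n" by (metis UNIV_I imageE)
  have "(of_nat n :: 'k) ^ p = of_nat n"
  proof (induction n)
    case 0 then show ?case using prime_gt_0_nat[OF p(1)] by simp
  next
    case (Suc n)
    have "(of_nat n + 1 :: 'k) ^ p = of_nat n ^ p + 1 ^ p"
      by (rule freshmans_dream) (simp_all add: c p)
    then show ?case using Suc by (simp add: add.commute)
  qed
  then show ?thesis by (simp add: x)
qed

lemma alg_closed_quadratic_root:
  fixes b c :: "'a::alg_closed_field"
  obtains x where "x * x = b * x + c"
proof -
  have "\<exists>x. poly [: - c, - b, 1 :] x = 0" by (rule alg_closed_imp_poly_has_root) simp
  then show ?thesis using that by (auto simp: algebra_simps)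
qed

text \<open>Writing an element as \<open>z + inverse z\<close> turns the Frobenius map into
  arithmetic of exponents.\<close>

lemma alg_closed_sum_inverse:
  fixes s :: "'a::alg_closed_field"
  obtains z where "z \<noteq> 0" "s = z + inverse z"
proof -
  obtain z where z: "z * z = s * z + (- 1)" by (rule alg_closed_quadratic_root)
  then have z0: "z \<noteq> 0" by auto
  have "(z + inverse z) * z = s * z" using z0 z by (simp add: distrib_right)
  then show ?thesis using that z0 by auto
qed

text \<open>Since \<open>z ^ (2 * m) = 1\<close>, only the residue of \<open>p\<close> modulo
  \<open>2 * m\<close> matters for \<open>z ^ p\<close>.\<close>

lemma frobenius_sum_inverse:
  fixes z :: "'k::{field,finite} alg_closure"
  assumes p: "prime p" "card (UNIV :: 'k set) = p" and z: "z \<noteq> 0"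
    and m: "z ^ m = - 1" "m > 0" and pm: "p mod (2 * m) = e"
  shows "(z + inverse z) ^ p = z ^ e + inverse (z ^ e)"
proof -
  have "(z + inverse z) ^ p = z ^ p + inverse z ^ p"
    by (rule freshmans_dream) (simp_all add: CHAR_prime_card[OF p] p)
  moreover have "z ^ p = z ^ e"
  proof -
    have "z ^ p = z ^ (2 * m * (p div (2 * m)) + e)" using pm by (metis mult_div_mod_eq)
    also have "\<dots> = ((z ^ m) ^ 2) ^ (p div (2 * m)) * z ^ e"
      by (simp add: power_add power_mult power_mult_distrib mult.commute flip: power_mult)
    finally show ?thesis by (simp add: m)
  qed
  ultimately show ?thesis by (simp add: power_inverse)
qed

text \<open>Here the Frobenius map negates \<open>z + inverse z\<close>, because
  \<open>z ^ (m + 1) = - z\<close> and \<open>z ^ (m - 1) = - inverse z\<close>; yet it fixes every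
  element of the base field, so \<open>a = - a\<close>.\<close>

lemma sum_inverse_in_field_zero:
  fixes a :: "'k::{field,finite}"
  assumes p: "prime p" "card (UNIV :: 'k set) = p" and z: "z \<noteq> 0" "to_ac a = z + inverse z"
    and m: "z ^ m = - 1" "m > 0" and pm: "p mod (2 * m) = m + 1 \<or> p mod (2 * m) = m - 1"
  shows "2 * a = 0"
proof -
  have eq: "to_ac a = (z + inverse z) ^ p"
    using power_prime_card_eq_same[OF p, of a] z(2) by (metis to_ac_power)
  have "z ^ (m + 1) = - z" using m by simp
  moreover have "z ^ (m - 1) = - inverse z"
  proof -
    have "z ^ (m - 1) * z = - 1" using m by (metis Suc_pred' power_Suc2 One_nat_def)
    then show ?thesis using z(1) by (simp add: field_simps)
  qed
  ultimately have "z ^ e + inverse (z ^ e) = - (z + inverse z)" if "e = m + 1 \<or> e = m - 1" for e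
    using that by (elim disjE) (simp_all only: inverse_minus_eq inverse_inverse_eq, simp_all)
  then have "(z + inverse z) ^ p = - (z + inverse z)"
    using pm frobenius_sum_inverse[OF p z(1) m refl] by metis
  then have "to_ac a = - to_ac a" using eq z(2) by simp
  then have "to_ac a = to_ac (- a)" by simp
  then have "a = - a" by (simp only: to_ac_eq_iff)
  then have "a + a = 0" by (metis add.right_inverse)
  then show ?thesis by simp
qed

text \<open>Here the Frobenius map fixes \<open>z + inverse z\<close>. Its fixed points are the
  roots of \<open>x ^ p - x\<close>, at most \<open>p\<close> in number, and the base field already
  supplies \<open>p\<close> of them.\<close>

lemma sum_inverse_in_field:
  fixes z :: "'k::{field,finite} alg_closure"
  assumes p: "prime p" "card (UNIV :: 'k set) = p" and z: "z \<noteq> 0"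
    and m: "z ^ m = - 1" "m > 1" and pm: "p mod (2 * m) = 1 \<or> p mod (2 * m) = 2 * m - 1"
  shows "z + inverse z \<in> range to_ac"
proof -
  let ?P = "monom 1 p + monom (- 1) 1 :: 'k alg_closure poly"
  have p1: "p > 1" using p(1) prime_gt_1_nat by blast
  have deg: "degree ?P = p" using p1 by (subst degree_add_eq_left) (simp_all add: degree_monom_eq)
  then have P0: "?P \<noteq> 0" using p1 by auto
  have roots: "{x. poly ?P x = 0} = {x. x ^ p = x}" by (auto simp: poly_monom)
  have sub: "range to_ac \<subseteq> {x :: 'k alg_closure. x ^ p = x}"
    using power_prime_card_eq_same[OF p] by (auto simp flip: to_ac_power)
  have fin: "finite {x :: 'k alg_closure. x ^ p = x}" using poly_roots_finite[OF P0] roots by simp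
  have "card {x :: 'k alg_closure. x ^ p = x} \<le> p" using card_poly_roots_bound[OF P0] deg roots by simp
  moreover have "card (range (to_ac :: 'k \<Rightarrow> _)) = p" using p(2) by (simp add: card_image inj_to_ac)
  ultimately have eq: "range to_ac = {x :: 'k alg_closure. x ^ p = x}"
    using sub fin by (metis card_mono card_subset_eq le_antisym)
  have "z ^ (2 * m - 1) = inverse z"
  proof -
    have "z ^ (2 * m - 1) * z = z ^ (2 * m)" using m(2)
      by (metis One_nat_def Suc_pred less_trans mult_pos_pos power_Suc2 zero_less_numeral zero_less_one)
    also have "\<dots> = (z ^ m) ^ 2" by (simp add: mult.commute flip: power_mult)
    finally show ?thesis using m z by (simp add: field_simps)
  qed
  then have "z ^ e + inverse (z ^ e) = z + inverse z" if "e = 1 \<or> e = 2 * m - 1" for e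
    using that by (elim disjE) (simp_all only: inverse_inverse_eq power_one_right add.commute)
  moreover have "m > 0" using m(2) by simp
  ultimately have "(z + inverse z) ^ p = z + inverse z"
    using pm frobenius_sum_inverse[OF p z m(1) _ refl] by metis
  then show ?thesis using eq by blast
qed

text \<open>A counting argument: every nonzero square has at most two roots, so the set
  \<open>S\<close> of nonzero squares is at least half of the nonzero elements. Its translate by
  \<open>a\<close> is disjoint from it and equally large, so the two exhaust the nonzero elements
  and \<open>b\<close> lies in the translate.\<close>

lemma nonsquares_mult_square:
  fixes a b :: "'k::{field,finite}"
  assumes a: "\<And>s. a \<noteq> s * s" and b: "\<And>s. b \<noteq> s * s"
  shows "\<exists>s. a * b = s * s"
proof -
  define S where "S = (\<lambda>x::'k. x * x) ` (- {0})"
  define r where "r = (\<lambda>y::'k. SOME x. y = x * x)"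
  have r: "x = r (x * x) \<or> x = - r (x * x)" for x
  proof -
    have "x * x = r (x * x) * r (x * x)" unfolding r_def by (rule someI_ex) blast
    then show ?thesis by (simp only: square_eq_iff)
  qed
  have "- {0} \<subseteq> r ` S \<union> (\<lambda>y. - r y) ` S"
    unfolding S_def using r by blast
  then have "card (- {0::'k}) \<le> card (r ` S \<union> (\<lambda>y. - r y) ` S)" by (intro card_mono) auto
  also have "\<dots> \<le> card S + card S"
    by (rule order_trans[OF card_Un_le]) (intro add_mono card_image_le; simp)
  finally have c: "card (- {0::'k}) \<le> card S + card S" .
  have a0: "a \<noteq> 0" using a[of 0] by simp
  have disj: "S \<inter> (\<lambda>x. a * x) ` S = {}"
  proof -
    have False if "x \<noteq> 0" "y * y = a * (x * x)" for x y :: 'k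
    proof -
      have "a = (y / x) * (y / x)" using that by (simp add: field_simps)
      then show False using a by blast
    qed
    then show ?thesis unfolding S_def by auto
  qed
  have "card ((\<lambda>x. a * x) ` S) = card S" using a0 by (intro card_image) (auto simp: inj_on_def)
  then have "card (S \<union> (\<lambda>x. a * x) ` S) = card S + card S" using disj by (simp add: card_Un_disjoint)
  moreover have "S \<union> (\<lambda>x. a * x) ` S \<subseteq> - {0}" using a0 by (auto simp: S_def)
  ultimately have "S \<union> (\<lambda>x. a * x) ` S = - {0}" using c
    by (intro card_seteq) auto
  moreover have "b \<noteq> 0" using b[of 0] by simp
  ultimately have "b \<in> S \<union> (\<lambda>x. a * x) ` S" by blast
  then obtain x where "b = a * (x * x)" using b unfolding S_def by auto
  then have "a * b = (a * x) * (a * x)" by simp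
  then show ?thesis by blast
qed

text \<open>A number whose sum with its inverse is the golden ratio is a tenth root of unity: the
  cofactor of \<open>w + 1\<close> in \<open>w ^ 5 + 1\<close> is
  \<open>w * w * (u * u - u - 1)\<close>.\<close>

lemma power_5_golden:
  fixes u w :: "'a::comm_ring_1"
  assumes u: "u * u = u + 1" and w: "w * u = w * w + 1"
  shows "w ^ 5 = - 1"
proof -
  have "w ^ 5 + 1 = (w + 1) * ((w * w + 1) * (w * w + 1) - w * (w * w + 1) - w * w)"
    by (simp add: algebra_simps eval_nat_numeral)
  also have "(w * w + 1) * (w * w + 1) - w * (w * w + 1) - w * w = w * w * (u * u - (u + 1))"
    unfolding w[symmetric] by (simp add: algebra_simps)
  finally show ?thesis using u by (simp add: eq_neg_iff_add_eq_0)
qed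

text \<open>A square root of 2, 3 or \<open>f + 2\<close> would be \<open>z + inverse z\<close> with
  \<open>z ^ m = - 1\<close> for \<open>m\<close> equal to 4, 6 or 10, and in each case
  \<open>p\<close> is \<open>m + 1\<close> or \<open>m - 1\<close> modulo \<open>2 * m\<close>. For
  \<open>f + 2\<close> the square \<open>z * z\<close> is the number whose sum with its inverse is
  \<open>f\<close>.\<close>

lemma quadratic_residues_120:
  assumes p: "prime p" "card (UNIV :: 'k::{field,finite} set) = p" and pm: "p mod 120 \<in> {29, 91}"
  shows "\<exists>f::'k. f * f = f + 1 \<and> (\<forall>s::'k. s * s \<notin> {2, 3, f + 2, 3 - f}) \<and> (2::'k) \<noteq> 0"
proof -
  have mods: "p mod 8 \<in> {5, 3}" "p mod 12 \<in> {5, 7}" "p mod 20 \<in> {9, 11}" "p mod 10 \<in> {9, 1}"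
  proof -
    have "p mod 8 = p mod 120 mod 8" "p mod 12 = p mod 120 mod 12"
      "p mod 20 = p mod 120 mod 20" "p mod 10 = p mod 120 mod 10"
      by (simp_all add: mod_mod_cancel)
    then show "p mod 8 \<in> {5, 3}" "p mod 12 \<in> {5, 7}" "p mod 20 \<in> {9, 11}" "p mod 10 \<in> {9, 1}"
      using pm by auto
  qed
  have char: "(of_nat n :: 'k) = 0 \<longleftrightarrow> p dvd n" for n
    using CHAR_prime_card[OF p] by (simp add: of_nat_eq_0_iff_char_dvd)
  have "p \<ge> 29" using pm mod_less_eq_dividend[of p 120] by auto
  then have "\<not> p dvd 2" "\<not> p dvd 3" using dvd_imp_le[of p 2] dvd_imp_le[of p 3] by auto
  then have two: "(2::'k) \<noteq> 0" and three: "(3::'k) \<noteq> 0" using char[of 2] char[of 3] by simp_all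
  have ns: "s * s \<noteq> c" if "c \<noteq> 0" and z: "\<And>z. z \<noteq> 0 \<Longrightarrow> (z + inverse z) * (z + inverse z) = to_ac c \<Longrightarrow> z ^ m = - 1"
    and m: "m > 0" and pm: "p mod (2 * m) \<in> {m + 1, m - 1}" for s c :: 'k and m
  proof
    assume s: "s * s = c"
    obtain z where z0: "z \<noteq> 0" and sz: "to_ac s = z + inverse z" by (rule alg_closed_sum_inverse)
    have "(z + inverse z) * (z + inverse z) = to_ac c" using s sz by (metis to_ac_mult)
    from sum_inverse_in_field_zero[OF p z0 sz z[OF z0 this] m] have "2 * s = 0" using pm by blast
    then show False using two s that(1) by simp
  qed
  have inv: "z * z * ((z + inverse z) * (z + inverse z)) = (z * z + 1) * (z * z + 1)" if "z \<noteq> 0"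
    for z :: "'k alg_closure"
  proof -
    have "z * z * ((z + inverse z) * (z + inverse z)) = (z * (z + inverse z)) * (z * (z + inverse z))"
      by (simp only: mult_ac)
    then show ?thesis using that by (simp add: distrib_left)
  qed
  have ns2: "s * s \<noteq> 2" for s :: 'k
  proof (rule ns[where m = 4])
    fix z :: "'k alg_closure" assume "z \<noteq> 0" "(z + inverse z) * (z + inverse z) = to_ac 2"
    from inv[OF this(1)] this have "(z * z + 1) * (z * z + 1) = z * z * 2" by simp
    moreover have "z ^ 4 + 1 = (z * z + 1) * (z * z + 1) - z * z * 2"
      by (simp add: algebra_simps eval_nat_numeral)
    ultimately show "z ^ 4 = - 1" by (simp add: eq_neg_iff_add_eq_0)
  qed (use two mods in auto)
  have ns3: "s * s \<noteq> 3" for s :: 'k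
  proof (rule ns[where m = 6])
    fix z :: "'k alg_closure" assume "z \<noteq> 0" "(z + inverse z) * (z + inverse z) = to_ac 3"
    from inv[OF this(1)] this have "(z * z + 1) * (z * z + 1) = z * z * 3" by simp
    moreover have "z ^ 6 + 1 = (z * z + 1) * ((z * z + 1) * (z * z + 1) - z * z * 3)"
      by (simp add: algebra_simps eval_nat_numeral)
    ultimately show "z ^ 6 = - 1" by (simp add: eq_neg_iff_add_eq_0)
  qed (use three mods in auto)
  have ns5: "s * s \<noteq> f + 2" if f: "f * f = f + 1" for f s :: 'k
  proof (rule ns[where m = 10])
    show "f + 2 \<noteq> 0"
    proof
      assume "f + 2 = 0"
      then have "f = - 2" by (simp add: add_eq_0_iff2)
      then have "(- 2) * (- 2) = (- 2) + (1::'k)" using f by (simp only:)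
      moreover have "(5::'k) = (- 2) * (- 2) - ((- 2) + 1)" by simp
      ultimately have "(5::'k) = 0" by (simp only: diff_self)
      moreover have "\<not> p dvd 5" using \<open>p \<ge> 29\<close> dvd_imp_le[of p 5] by auto
      ultimately show False using char[of 5] by simp
    qed
  next
    fix z :: "'k alg_closure" assume z: "z \<noteq> 0" "(z + inverse z) * (z + inverse z) = to_ac (f + 2)"
    define u where "u = to_ac f"
    have u: "u * u = u + 1" unfolding u_def using f by (metis to_ac_1 to_ac_add to_ac_mult)
    have "(z * z + 1) * (z * z + 1) = z * z * (u + 2)"
      using inv[OF z(1)] z(2) by (simp add: u_def)
    then have "(z * z) * u = (z * z) * (z * z) + 1" by (simp add: algebra_simps)
    with u have "(z * z) ^ 5 = - 1" by (rule power_5_golden)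
    then show "z ^ 10 = - 1" by (simp flip: power2_eq_square power_mult)
  qed (use mods in auto)
  \<comment> \<open>The golden ratio is first found in the algebraic closure; it descends to the
    base field because \<open>p\<close> is 1 or 9 modulo 10.\<close>
  obtain u :: "'k alg_closure" where u: "u * u = 1 * u + 1" by (rule alg_closed_quadratic_root)
  obtain z where z: "z \<noteq> 0" "u = z + inverse z" by (rule alg_closed_sum_inverse)
  have "z * u = z * z + 1" using z by (simp add: distrib_left)
  moreover have u1: "u * u = u + 1" using u by simp
  ultimately have z5: "z ^ 5 = - 1" using power_5_golden by blast
  from sum_inverse_in_field[OF p z(1) z5] mods(4) have "u \<in> range to_ac" using z(2) by auto
  then obtain f :: 'k where "u = to_ac f" by blast
  then have "to_ac (f * f) = to_ac (f + 1)" using u by simp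
  then have f: "f * f = f + 1" by (simp only: to_ac_eq_iff)
  \<comment> \<open>The other root \<open>1 - f\<close> of the same equation settles the fourth
    value, as \<open>3 - f = (1 - f) + 2\<close>.\<close>
  then have "(1 - f) * (1 - f) = (1 - f) + 1" by (simp add: algebra_simps)
  then have "s * s \<noteq> 3 - f" for s using ns5[of "1 - f" s] by (simp add: algebra_simps)
  then have "s * s \<notin> {2, 3, f + 2, 3 - f}" for s using ns2 ns3 ns5[OF f] by blast
  then show ?thesis using f two by blast
qed

section \<open>Groups and solvable subgroups\<close>

text \<open>\<open>L\<close> is the last nontrivial term of the derived series: all terms are
  normal, and the next one being trivial makes it abelian.\<close>

lemma (in group) solvable_abelian_normal:
  assumes "solvable G" "carrier G \<noteq> {\<one>}"
  obtains L where "L \<lhd> G" "L \<noteq> {\<one>}" "\<And>x y. x \<in> L \<Longrightarrow> y \<in> L \<Longrightarrow> x \<otimes> y = y \<otimes> x"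
proof -
  let ?D = "\<lambda>n. (derived G ^^ n) (carrier G)"
  have ex: "\<exists>n. ?D n = {\<one>}" using assms(1) solvable_iff_trivial_derived_seq by blast
  define n where "n = (LEAST n. ?D n = {\<one>})"
  have n: "?D n = {\<one>}" unfolding n_def using ex by (rule LeastI_ex)
  then obtain m where m: "n = Suc m" using assms(2) by (cases n) auto
  have m1: "?D m \<noteq> {\<one>}" using not_less_Least[of m "\<lambda>n. ?D n = {\<one>}"] m n_def by simp
  have norm: "?D k \<lhd> G" for k
  proof (induction k)
    case 0 show ?case using normal_self by simp
  next
    case (Suc k) then show ?case using derived_is_normal by simp
  qed
  have "x \<otimes> y = y \<otimes> x" if xy: "x \<in> ?D m" "y \<in> ?D m" for x y
  proof -
    have c: "x \<in> carrier G" "y \<in> carrier G"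
      using xy subgroup.mem_carrier[OF normal_imp_subgroup[OF norm[of m]]] by auto
    have "x \<otimes> y \<otimes> inv x \<otimes> inv y \<in> derived G (?D m)"
      unfolding derived_def[of G "?D m"]
      by (rule generate.incl, rule UN_I[OF xy(1)], rule UN_I[OF xy(2)], rule singletonI)
    then have "x \<otimes> y \<otimes> inv x \<otimes> inv y = \<one>" using n m by simp
    then have "x \<otimes> y \<otimes> inv (y \<otimes> x) = \<one>" using c by (simp add: inv_mult_group m_assoc)
    then show ?thesis using c by (simp add: inv_solve_right' eq_commute[of \<one>])
  qed
  then show ?thesis using that norm m1 by blast
qed

lemma solvable_subgroups_iff:
  assumes "group G" "subgroup H G"
  shows "K \<in> solvable_subgroups G H \<longleftrightarrow> subgroup K G \<and> K \<subseteq> H \<and> solvable (G\<lparr>carrier := K\<rparr>)"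
proof -
  interpret group G by fact
  have "subgroup K (G\<lparr>carrier := H\<rparr>) \<longleftrightarrow> subgroup K G \<and> K \<subseteq> H"
    using incl_subgroup[OF assms(2)] subgroup_incl[OF _ assms(2)] subgroup.subset by fastforce
  then show ?thesis by (auto simp: solvable_subgroups_def)
qed

lemma hom_image_solvable_subgroup:
  assumes "group G" "group H" "h \<in> hom G H" "subgroup K G" "solvable (G\<lparr>carrier := K\<rparr>)"
  shows "subgroup (h ` K) H" "solvable (H\<lparr>carrier := h ` K\<rparr>)"
proof -
  interpret group_hom G H h using assms by (simp add: group_hom_def group_hom_axioms_def)
  show sub: "subgroup (h ` K) H" using subgroup_img_is_subgroup assms(4) .
  have "h \<in> hom (G\<lparr>carrier := K\<rparr>) (H\<lparr>carrier := h ` K\<rparr>)"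
    using assms(3) subgroup.mem_carrier[OF assms(4)] by (auto simp: hom_def)
  then have "group_hom (G\<lparr>carrier := K\<rparr>) (H\<lparr>carrier := h ` K\<rparr>) h"
    using G.subgroup_imp_group[OF assms(4)] H.subgroup_imp_group[OF sub]
    by (simp add: group_hom_def group_hom_axioms_def)
  then show "solvable (H\<lparr>carrier := h ` K\<rparr>)"
    using group_hom.surj_hom_imp_solvable assms(5) by fastforce
qed

lemma iso_image_solvable_subgroups:
  assumes G: "group G" and t: "t \<in> iso G G" and H: "subgroup H G" and K: "K \<in> solvable_subgroups G H"
  shows "t ` K \<in> solvable_subgroups G (t ` H)"
proof -
  have h: "t \<in> hom G G" using t by (simp add: iso_def)
  interpret group_hom G G t using G h by (simp add: group_hom_def group_hom_axioms_def)
  show ?thesis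
    using K hom_image_solvable_subgroup[OF G G h] subgroup_img_is_subgroup[OF H]
    unfolding solvable_subgroups_iff[OF G H] solvable_subgroups_iff[OF G subgroup_img_is_subgroup[OF H]]
    by blast
qed

lemma solvably_equivalent_iso_image:
  assumes G: "group G" and t: "t \<in> iso G G" and H: "subgroup H G"
    and conj: "\<And>K. K \<in> solvable_subgroups G H \<Longrightarrow> conjugate_in G K (t ` K)"
  shows "solvably_equivalent G H (t ` H)"
proof -
  interpret group G by fact
  have tb: "bij_betw t (carrier G) (carrier G)" and h: "t \<in> hom G G" using t by (auto simp: iso_def)
  interpret gh: group_hom G G t using G h by (simp add: group_hom_def group_hom_axioms_def)
  have tH: "subgroup (t ` H) G" using gh.subgroup_img_is_subgroup[OF H] .
  let ?u = "inv_into (carrier G) t"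
  have u: "?u \<in> iso G G" using iso_set_sym[OF t] .
  have ut: "?u ` t ` K = K" if "K \<subseteq> carrier G" for K
    using that tb by (force simp: bij_betw_def image_iff inv_into_f_f subset_iff)
  have tu: "t ` ?u ` K = K" if "K \<subseteq> carrier G" for K
    using that tb by (force simp: bij_betw_def image_iff f_inv_into_f subset_iff)
  have sub: "K \<subseteq> carrier G" if "K \<in> solvable_subgroups G U" "subgroup U G" for K U
    using that solvable_subgroups_iff[OF G that(2)] subgroup.subset by blast
  have "bij_betw ((`) t) (solvable_subgroups G H) (solvable_subgroups G (t ` H))"
  proof (rule bij_betw_byWitness[where f' = "(`) ?u"])
    show "\<forall>K\<in>solvable_subgroups G H. ?u ` t ` K = K" by (intro ballI ut sub[OF _ H])
    show "\<forall>K\<in>solvable_subgroups G (t ` H). t ` ?u ` K = K" by (intro ballI tu sub[OF _ tH])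
    show "(`) t ` solvable_subgroups G H \<subseteq> solvable_subgroups G (t ` H)"
      using iso_image_solvable_subgroups[OF G t H] by blast
    show "(`) ?u ` solvable_subgroups G (t ` H) \<subseteq> solvable_subgroups G H"
      using iso_image_solvable_subgroups[OF G u tH] ut[OF subgroup.subset[OF H]] by auto
  qed
  then show ?thesis unfolding solvably_equivalent_def using conj by blast
qed

lemma subgroup_iso_image:
  assumes G: "group G" and t: "t \<in> iso G G" and H: "subgroup H G"
  shows "G\<lparr>carrier := H\<rparr> \<cong> G\<lparr>carrier := t ` H\<rparr>"
proof -
  have "t \<in> iso (G\<lparr>carrier := H\<rparr>) (G\<lparr>carrier := t ` H\<rparr>)"
    using t subgroup.subset[OF H] unfolding iso_def hom_def bij_betw_def
    by (auto simp: inj_on_subset subset_iff)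
  then show ?thesis by (auto simp: is_iso_def)
qed

section \<open>The projection from SL2 to PSL2\<close>

abbreviation proj :: "('k::field ^ 2 ^ 2) \<Rightarrow> ('k ^ 2 ^ 2) set" where
  "proj A \<equiv> SL2_pm1 #>\<^bsub>SL2\<^esub> A"

lemma proj_hom: "proj \<in> hom (SL2 :: ('k::field ^ 2 ^ 2) monoid) PSL2"
  unfolding PSL2_def by (rule normal.r_coset_hom_Mod[OF normal_SL2_pm1])

lemma proj_eq: "proj (A :: 'k::field ^ 2 ^ 2) = {A, - A}"
proof -
  have "- mat 1 ** A = - A" by (simp add: matrix_matrix_mult_def vec_eq_iff mat_def sum_negf if_distrib cong: if_cong)
     (simp add: sum_2 forall_2)
  then show ?thesis by (auto simp: r_coset_def SL2_pm1_def SL2_def)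
qed

lemma carrier_PSL2: "carrier PSL2 = proj ` carrier (SL2 :: ('k::field ^ 2 ^ 2) monoid)"
  by (auto simp: PSL2_def FactGroup_def RCOSETS_def)

lemma proj_group_hom: "group_hom (SL2 :: ('k::field ^ 2 ^ 2) monoid) PSL2 proj"
  using group_SL2 group_PSL2 proj_hom by (simp add: group_hom_def group_hom_axioms_def)

lemma conjugate_in_image:
  assumes "group_hom G H h" "K \<subseteq> carrier G" "conjugate_in G K L"
  shows "conjugate_in H (h ` K) (h ` L)"
proof -
  interpret group_hom G H h by fact
  obtain g where g: "g \<in> carrier G" "L = (\<lambda>k. g \<otimes>\<^bsub>G\<^esub> k \<otimes>\<^bsub>G\<^esub> inv\<^bsub>G\<^esub> g) ` K"
    using assms(3) by (auto simp: conjugate_in_def)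
  have "h (g \<otimes>\<^bsub>G\<^esub> k \<otimes>\<^bsub>G\<^esub> inv\<^bsub>G\<^esub> g) = h g \<otimes>\<^bsub>H\<^esub> h k \<otimes>\<^bsub>H\<^esub> inv\<^bsub>H\<^esub> h g" if "k \<in> K" for k
    using that assms(2) g(1) by (simp add: subset_iff)
  then have "h ` L = (\<lambda>x. h g \<otimes>\<^bsub>H\<^esub> x \<otimes>\<^bsub>H\<^esub> inv\<^bsub>H\<^esub> h g) ` h ` K"
    unfolding g(2) image_image by (rule image_cong[OF refl])
  then show ?thesis using hom_closed[OF g(1)] unfolding conjugate_in_def by (intro bexI)
qed

section \<open>Quaternions and the five frames\<close>

datatype 'a quat = Quat (qre: 'a) (qi: 'a) (qj: 'a) (qk: 'a)

instantiation quat :: (comm_ring_1) ring_1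
begin

definition "0 = Quat 0 0 0 0"
definition "1 = Quat 1 0 0 0"
definition "x + y = Quat (qre x + qre y) (qi x + qi y) (qj x + qj y) (qk x + qk y)"
definition "x - y = Quat (qre x - qre y) (qi x - qi y) (qj x - qj y) (qk x - qk y)"
definition "- x = Quat (- qre x) (- qi x) (- qj x) (- qk x)"
definition "x * y = Quat
  (qre x * qre y - qi x * qi y - qj x * qj y - qk x * qk y)
  (qre x * qi y + qi x * qre y + qj x * qk y - qk x * qj y)
  (qre x * qj y - qi x * qk y + qj x * qre y + qk x * qi y)
  (qre x * qk y + qi x * qj y - qj x * qi y + qk x * qre y)"

instance
  by standard
    (auto simp: zero_quat_def one_quat_def plus_quat_def minus_quat_def uminus_quat_def
      times_quat_def algebra_simps)

end

lemma quat_sel [simp]: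
  "qre 0 = 0" "qi 0 = 0" "qj 0 = 0" "qk 0 = 0"
  "qre 1 = 1" "qi 1 = 0" "qj 1 = 0" "qk 1 = 0"
  "qre (x + y) = qre x + qre y" "qi (x + y) = qi x + qi y"
  "qj (x + y) = qj x + qj y" "qk (x + y) = qk x + qk y"
  "qre (x - y) = qre x - qre y" "qi (x - y) = qi x - qi y"
  "qj (x - y) = qj x - qj y" "qk (x - y) = qk x - qk y"
  "qre (- x) = - qre x" "qi (- x) = - qi x" "qj (- x) = - qj x" "qk (- x) = - qk x"
  "qre (x * y) = qre x * qre y - qi x * qi y - qj x * qj y - qk x * qk y"
  "qi (x * y) = qre x * qi y + qi x * qre y + qj x * qk y - qk x * qj y"
  "qj (x * y) = qre x * qj y - qi x * qk y + qj x * qre y + qk x * qi y"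
  "qk (x * y) = qre x * qk y + qi x * qj y - qj x * qi y + qk x * qre y"
  by (simp_all add: zero_quat_def one_quat_def plus_quat_def minus_quat_def uminus_quat_def
      times_quat_def)

lemma quat_eq_iff: "x = y \<longleftrightarrow> qre x = qre y \<and> qi x = qi y \<and> qj x = qj y \<and> qk x = qk y"
  by (cases x; cases y) auto

definition scalar :: "'a::comm_ring_1 \<Rightarrow> 'a quat" where "scalar a = Quat a 0 0 0"

definition qcnj :: "'a::comm_ring_1 quat \<Rightarrow> 'a quat"
  where "qcnj x = Quat (qre x) (- qi x) (- qj x) (- qk x)"

definition qnorm :: "'a::comm_ring_1 quat \<Rightarrow> 'a"
  where "qnorm x = qre x * qre x + qi x * qi x + qj x * qj x + qk x * qk x"

lemma scalar_sel [simp]: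
  "qre (scalar a) = a" "qi (scalar a) = 0" "qj (scalar a) = 0" "qk (scalar a) = 0"
  by (simp_all add: scalar_def)

lemma qcnj_sel [simp]:
  "qre (qcnj x) = qre x" "qi (qcnj x) = - qi x" "qj (qcnj x) = - qj x" "qk (qcnj x) = - qk x"
  by (simp_all add: qcnj_def)

lemma scalar_simps [simp]:
  "scalar 1 = 1" "scalar 0 = 0"
  by (simp_all add: quat_eq_iff)

lemma scalar_hom:
  "scalar (a + b) = scalar a + scalar b" "scalar (a - b) = scalar a - scalar b"
  "scalar (- a) = - scalar a" "scalar (a * b) = scalar a * scalar b"
  by (simp_all add: quat_eq_iff)

lemma scalar_eq_iff [simp]: "scalar a = scalar b \<longleftrightarrow> a = b"
  by (simp add: scalar_def)

lemma scalar_commute: "x * scalar a = scalar a * x"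
  by (simp add: quat_eq_iff mult.commute)

lemma qcnj_simps [simp]:
  "qcnj 1 = 1" "qcnj (- x) = - qcnj x" "qcnj (qcnj x) = x" "qcnj (scalar a) = scalar a"
  "qcnj (x + y) = qcnj x + qcnj y"
  by (simp_all add: quat_eq_iff)

lemma qcnj_mult [simp]: "qcnj (x * y) = qcnj y * qcnj x"
  by (simp add: quat_eq_iff algebra_simps)

lemma mult_qcnj: "x * qcnj x = scalar (qnorm x)" "qcnj x * x = scalar (qnorm x)"
  by (simp_all add: quat_eq_iff qnorm_def algebra_simps)

lemma qnorm_simps [simp]:
  "qnorm 1 = 1" "qnorm (- x) = qnorm x" "qnorm (qcnj x) = qnorm x" "qnorm (scalar a) = a * a"
  by (simp_all add: qnorm_def)

lemma qnorm_mult [simp]: "qnorm (x * y) = qnorm x * qnorm y"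
  by (simp add: qnorm_def algebra_simps)

lemma unit_qcnj: 
  assumes "qnorm h = 1"
  shows "h * qcnj h = 1" "qcnj h * h = 1" "h * (qcnj h * x) = x" "qcnj h * (h * x) = x"
  using assms by (simp_all add: mult_qcnj flip: mult.assoc)

lemma quat_square: "x * x = scalar (2 * qre x) * x - scalar (qnorm x)"
  by (simp add: quat_eq_iff qnorm_def algebra_simps)

text \<open>Division-free, hence genuine conjugation only for \<open>h\<close> of norm 1; other
  norms are handled by \<open>nconj\<close>.\<close>

definition conj_by :: "'a::comm_ring_1 quat \<Rightarrow> 'a quat \<Rightarrow> 'a quat"
  where "conj_by h v = h * v * qcnj h"

lemma conj_by_mult: "conj_by (g * h) v = conj_by g (conj_by h v)"
  by (simp add: conj_by_def mult.assoc)

lemma conj_by_one [simp]: "conj_by 1 = id"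
  by (simp add: conj_by_def fun_eq_iff)

lemma conj_by_uminus: "conj_by h (- v) = - conj_by h v"
  by (simp add: conj_by_def)

lemma conj_by_neg [simp]: "conj_by (- h) = conj_by h"
  by (simp add: conj_by_def fun_eq_iff)

lemma conj_by_image_mult: "conj_by (g * h) ` S = conj_by g ` (conj_by h ` S)"
  by (simp add: conj_by_mult image_image)

lemma conj_by_qcnj:
  assumes "qnorm h = 1"
  shows "conj_by (qcnj h) (conj_by h v) = v" "conj_by h (conj_by (qcnj h) v) = v"
  using assms by (simp_all add: unit_qcnj flip: conj_by_mult)

text \<open>
  The edge midpoints of an icosahedron split into five orthogonal frames. Here \<open>f\<close> is the golden
  ratio, all vectors are scaled by 2 to avoid denominators, and any index outside \<open>{1..4}\<close> gives
  the standard frame.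
\<close>

definition frame :: "'a::comm_ring_1 \<Rightarrow> nat \<Rightarrow> 'a quat set" where
  "frame f n = (let V = (
     if n = 1 then {Quat 0 1 f (f-1), Quat 0 f (1-f) (-1), Quat 0 (f-1) (-1) f} else
     if n = 2 then {Quat 0 1 (-f) (f-1), Quat 0 f (f-1) (-1), Quat 0 (f-1) 1 f} else
     if n = 3 then {Quat 0 1 (-f) (1-f), Quat 0 f (f-1) 1, Quat 0 (f-1) 1 (-f)} else
     if n = 4 then {Quat 0 1 f (1-f), Quat 0 f (1-f) 1, Quat 0 (f-1) (-1) (-f)} else
     {Quat 0 2 0 0, Quat 0 0 2 0, Quat 0 0 0 2})
   in V \<union> uminus ` V)"

text \<open>The unit quaternions lying over the permutation \<open>s\<close> of the frames. Only the
  values of \<open>s\<close> on the five indices count, so \<open>s\<close> is determined by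
  \<open>h\<close> only among permutations of these indices.\<close>

definition stab :: "'a::comm_ring_1 \<Rightarrow> (nat \<Rightarrow> nat) \<Rightarrow> 'a quat set" where
  "stab f s = {h. qnorm h = 1 \<and> (\<forall>n\<in>{1..5}. conj_by h ` frame f n = frame f (s n))}"

section \<open>Explicit quaternions permuting the frames\<close>

locale golden =
  fixes f :: "'k::field"
  assumes ff: "f * f = f + 1"
    and two: "(2::'k) \<noteq> 0"
begin

lemma fff: "f * (f * x) = f * x + x"
  unfolding mult.assoc[symmetric] ff by (simp add: distrib_right)

definition "ii = Quat 0 1 0 (0::'k)"
definition "jj = Quat 0 0 1 (0::'k)"
definition "om = Quat (1/2) (1/2) (1/2) (1/2::'k)"
text \<open>Half of the first vector of \<open>frame f 1\<close>, so it acts as the half-turn about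
  an edge midpoint.\<close>

definition "xx = Quat 0 (1/2) (f/2) ((f-1)/2)"

lemma four: "(4::'k) \<noteq> 0"
  using no_zero_divisors[OF two two] by simp

lemma eight: "(8::'k) \<noteq> 0"
  using no_zero_divisors[OF two four] by simp

lemma numeral_neq: "(1::'k) \<noteq> 2" "(4::'k) \<noteq> 3" "f \<noteq> 1" "f \<noteq> 2"
proof -
  have "(2::'k) - 1 \<noteq> 0" "(4::'k) - 3 \<noteq> 0" by simp_all
  then show "(1::'k) \<noteq> 2" "(4::'k) \<noteq> 3" unfolding right_minus_eq by metis+
  show "f \<noteq> 2" using ff \<open>(4::'k) \<noteq> 3\<close> by auto
  show "f \<noteq> 1"
  proof
    assume "f = 1"
    then show False using ff \<open>(1::'k) \<noteq> 2\<close> by simp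
  qed
qed

lemma atLeastAtMost_1_5: "{1..5::nat} = {1,2,3,4,5}" by auto

lemma ii_stab: "ii \<in> stab f (Transposition.transpose 1 3 \<circ> Transposition.transpose 2 4)"
  unfolding stab_def atLeastAtMost_1_5
  by (simp add: ii_def qnorm_def frame_def conj_by_def quat_eq_iff Transposition.transpose_def)
    (auto simp add: uminus_quat_def times_quat_def)

lemma conj_by_om: "conj_by om (Quat 0 b c d) = Quat 0 d b c"
proof -
  have "qnorm om = 1" by (simp add: om_def qnorm_def four field_simps)
  moreover have "om * Quat 0 b c d = Quat 0 d b c * om"
    by (simp add: om_def times_quat_def)
  ultimately show ?thesis by (simp add: conj_by_def mult.assoc unit_qcnj)
qed

lemma om_stab: "om \<in> stab f (Transposition.transpose 1 2 \<circ> Transposition.transpose 2 3)"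
proof -
  have "qnorm om = 1" by (simp add: om_def qnorm_def four field_simps)
  then show ?thesis
  unfolding stab_def atLeastAtMost_1_5
  by (simp add: frame_def conj_by_om conj_by_uminus image_Un image_image)
    (auto simp add: uminus_quat_def Transposition.transpose_def)
qed

lemma qnorm_xx: "qnorm xx = 1"
  using no_zero_divisors[OF four four] by (simp add: xx_def qnorm_def four field_simps ff)

text \<open>Since \<open>xx\<close> is a pure unit quaternion, it acts as the half-turn that sends a
  vector to twice its projection onto \<open>xx\<close> minus the vector; \<open>s\<close> is the
  scalar product with \<open>xx\<close>.\<close>

lemma conj_by_xx: 
  assumes "b + f * c + (f - 1) * d = 2 * s"
  shows "conj_by xx (Quat 0 b c d) = Quat 0 (s - b) (s * f - c) (s * (f - 1) - d)"
proof -
  have b: "b = 2 * s - f * c - (f - 1) * d" using assms by (simp add: algebra_simps)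
  have "xx * Quat 0 b c d = Quat 0 (s - b) (s * f - c) (s * (f - 1) - d) * xx"
    unfolding b by (simp add: xx_def times_quat_def two four eight field_simps ff fff)
  with qnorm_xx show ?thesis by (simp add: conj_by_def mult.assoc unit_qcnj)
qed

text \<open>One instance for each of the fifteen frame vectors up to sign, with its scalar product
  as last argument.\<close>

lemmas conj_by_xx_frame =
  conj_by_xx[of 2 0 0 1] conj_by_xx[of 0 2 0 f] conj_by_xx[of 0 0 2 "f - 1"]
  conj_by_xx[of 1 f "f-1" 2] conj_by_xx[of f "1-f" "-1" 0] conj_by_xx[of "f-1" "-1" f 0]
  conj_by_xx[of 1 "-f" "f-1" "1-f"] conj_by_xx[of f "f-1" "-1" 1] conj_by_xx[of "f-1" 1 f f]
  conj_by_xx[of 1 "-f" "1-f" "-1"] conj_by_xx[of f "f-1" 1 "f"] conj_by_xx[of "f-1" 1 "-f" "f-1"]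
  conj_by_xx[of 1 f "1-f" "f"] conj_by_xx[of f "1-f" 1 "f-1"] conj_by_xx[of "f-1" "-1" "-f" "-1"]

lemma xx_stab: "xx \<in> stab f (Transposition.transpose 3 5 \<circ> Transposition.transpose 2 4)"
  using qnorm_xx unfolding stab_def atLeastAtMost_1_5
  apply (simp add: frame_def conj_by_xx_frame conj_by_uminus image_Un image_image algebra_simps ff fff)
  apply (auto simp add: uminus_quat_def Transposition.transpose_def algebra_simps ff)
  done

lemma golden_neq: "f \<noteq> 0" "f \<noteq> 1" "f \<noteq> - 1" "f \<noteq> 2" "f \<noteq> - f" "1 \<noteq> (- 1::'k)"
  "1 \<noteq> f" "-1 \<noteq> f" "- f \<noteq> f" "- 1 \<noteq> (1::'k)" "1 \<noteq> - f" "- f \<noteq> 1"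
proof -
  show *: "f \<noteq> 0" "f \<noteq> 1" "f \<noteq> - 1" "f \<noteq> 2" using ff numeral_neq by auto
  show 1: "1 \<noteq> (- 1::'k)" using two by (metis add.right_inverse one_add_one)
  have "f + f = f * 2" by simp
  then show "f \<noteq> - f" using no_zero_divisors[OF *(1) two] by (metis add.right_inverse)
  then show "- f \<noteq> f" by metis
  show "1 \<noteq> f" "-1 \<noteq> f" "- 1 \<noteq> (1::'k)" using * 1 by metis+
  show "1 \<noteq> - f" "- f \<noteq> 1" using *(3) by (metis minus_minus)+
qed

text \<open>One chosen vector per frame is enough to tell the frames apart.\<close>

lemma first_vector_frame: "i \<in> {1..5} \<Longrightarrow> j \<in> {1..5} \<Longrightarrow> i \<noteq> j \<Longrightarrow> 
  (if j = 1 then Quat 0 1 f (f-1) else if j = 2 then Quat 0 1 (-f) (f-1) else if j = 3 then Quat 0 1 (-f) (1-f)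
   else if j = 4 then Quat 0 1 f (1-f) else Quat 0 2 0 0) \<notin> frame f i"
  unfolding atLeastAtMost_1_5
  by (auto simp: frame_def uminus_quat_def golden_neq two numeral_neq(1,2) algebra_simps)


lemma inj_frame: "inj_on (frame f) {1..5}"
proof (rule inj_onI)
  fix i j :: nat assume ij: "i \<in> {1..5}" "j \<in> {1..5}" and eq: "frame f i = frame f j"
  have "(if j = 1 then Quat 0 1 f (f-1) else if j = 2 then Quat 0 1 (-f) (f-1) else if j = 3 then Quat 0 1 (-f) (1-f)
   else if j = 4 then Quat 0 1 f (1-f) else Quat 0 2 0 0) \<in> frame f j"
    by (simp add: frame_def)
  then show "i = j" using first_vector_frame[OF ij] eq by metis
qed

end

section \<open>Permutations of five points\<close>

text \<open>The permutation is encoded by its five values, each drawn from a list that omits its own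
  index, which turns the claim about derangements into a finite evaluation.\<close>

lemma derangement_5_list:
  "list_all (\<lambda>a. list_all (\<lambda>b. a \<noteq> b \<longrightarrow>
     list_all (\<lambda>c. a \<noteq> c \<and> b \<noteq> c \<longrightarrow>
     list_all (\<lambda>d. a \<noteq> d \<and> b \<noteq> d \<and> c \<noteq> d \<longrightarrow>
     list_all (\<lambda>e. a \<noteq> e \<and> b \<noteq> e \<and> c \<noteq> e \<and> d \<noteq> e \<longrightarrow>
     (let s = (\<lambda>n. if n = 1 then a else if n = 2 then b else if n = 3 then c else if n = 4 then d else e) in
       list_all (\<lambda>n. s (s (s (s (s n)))) = n) [1,2,3,4,5] \<or>
       list_ex (\<lambda>n. n \<noteq> s n \<and>
         list_all (\<lambda>m. s (s (s m)) = (if m = n then s n else if m = s n then n else m)) [1,2,3,4,5])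
         [1,2,3,4,5]))
   [1,2,3,4::nat]) [1,2,3,5]) [1,2,4,5]) [1,3,4,5]) [2,3,4,5]"
  by code_simp

text \<open>A derangement of five points is a 5-cycle or has type (2, 3), and then its cube is a transposition.\<close>

lemma derangement_5_cases:
  assumes s: "s permutes {1..5::nat}" and ne: "\<And>n. n \<in> {1..5} \<Longrightarrow> s n \<noteq> n"
  shows "s \<circ> s \<circ> s \<circ> s \<circ> s = id \<or>
    (\<exists>n\<in>{1..5}. s n \<noteq> n \<and> s \<circ> s \<circ> s = Transposition.transpose n (s n))"
proof -
  have i: "s n = s m \<longleftrightarrow> n = m" for n m using permutes_inj[OF s] by (simp add: inj_eq)
  have out: "s n = n" if "n \<notin> {1..5}" for n using permutes_not_in[OF s that] .
  have r: "s n \<in> {1,2,3,4,5}" if "n \<in> {1,2,3,4,5}" for n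
    using permutes_in_image[OF s, of n] that by auto
  have d: "s 1 \<in> {2,3,4,5}" "s 2 \<in> {1,3,4,5}" "s 3 \<in> {1,2,4,5}" "s 4 \<in> {1,2,3,5}" "s 5 \<in> {1,2,3,4}"
    using r[of 1] r[of 2] r[of 3] r[of 4] r[of 5] ne by simp_all
  define t where "t = (\<lambda>n::nat. if n = 1 then s 1 else if n = 2 then s 2 else if n = 3 then s 3
    else if n = 4 then s 4 else s 5)"
  have t: "t n = s n" if "n \<in> {1,2,3,4,5}" for n using that by (auto simp: t_def)
  have tt: "(\<forall>n\<in>{1,2,3,4,5}. t (t (t (t (t n)))) = n) \<or>
     (\<exists>n\<in>{1,2,3,4,5}. n \<noteq> t n \<and> (\<forall>m\<in>{1,2,3,4,5}. t (t (t m)) =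
       (if m = n then t n else if m = t n then n else m)))"
    using derangement_5_list[unfolded list_all_iff list_ex_iff list.set, rule_format,
        of "s 1" "s 2" "s 3" "s 4" "s 5", folded t_def, unfolded Let_def] d
    by (simp only: i) simp
  have t3: "t (t (t n)) = s (s (s n))" if "n \<in> {1,2,3,4,5}" for n
    using t r that by metis
  have t5: "t (t (t (t (t n)))) = s (s (s (s (s n))))" if "n \<in> {1,2,3,4,5}" for n
    using t3 t r that by metis
  have e: "{1..5} = {1,2,3,4,5::nat}" by auto
  from tt show ?thesis
  proof
    assume "\<forall>n\<in>{1,2,3,4,5}. t (t (t (t (t n)))) = n"
    then have "s (s (s (s (s n)))) = n" if "n \<in> {1,2,3,4,5}" for n
      using t5[OF that] that by metis
    then have "(s \<circ> s \<circ> s \<circ> s \<circ> s) n = id n" for n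
      using out by (cases "n \<in> {1..5}") (simp_all only: e comp_apply id_apply not_False_eq_True)
    then show ?thesis by blast
  next
    assume "\<exists>n\<in>{1,2,3,4,5}. n \<noteq> t n \<and> (\<forall>m\<in>{1,2,3,4,5}. t (t (t m)) =
       (if m = n then t n else if m = t n then n else m))"
    then obtain n where n: "n \<in> {1,2,3,4,5}" "n \<noteq> t n"
      and *: "\<forall>m\<in>{1,2,3,4,5}. t (t (t m)) = (if m = n then t n else if m = t n then n else m)"
      by blast
    have "s (s (s m)) = Transposition.transpose n (s n) m" if "m \<in> {1,2,3,4,5}" for m
      using *[rule_format, OF that] t3[OF that] t[OF n(1)] by (simp add: Transposition.transpose_def)
    moreover have "Transposition.transpose n (s n) m = m" if "m \<notin> {1..5}" for m
      using that n(1) r[OF n(1)] by (auto simp: Transposition.transpose_def)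
    ultimately have "(s \<circ> s \<circ> s) m = Transposition.transpose n (s n) m" for m
      using out by (cases "m \<in> {1..5}") (simp_all only: e comp_apply not_False_eq_True)
    then show ?thesis using n(1,2) t[OF n(1)] unfolding e by (metis ext)
  qed
qed

text \<open>For an involution the fifth power and the cube are both \<open>s\<close>, so a
  derangement would be the identity or a transposition, and both of these have fixed points.\<close>

lemma involution_5_fixpoint:
  assumes s: "s permutes {1..5::nat}" and ss: "s \<circ> s = id"
  shows "\<exists>e\<in>{1..5}. s e = e"
proof (rule ccontr)
  assume c: "\<not> ?thesis"
  have s1: "s (s n) = n" for n using ss by (metis comp_apply id_apply)
  have "\<exists>n\<in>{1..5}. s n \<noteq> n \<and> s = Transposition.transpose n (s n)"
  proof -
    have "s 1 \<noteq> 1" using c by simp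
    then have "s \<noteq> id" by auto
    moreover have "s \<circ> s \<circ> s \<circ> s \<circ> s = s" "s \<circ> s \<circ> s = s" by (auto simp: s1)
    ultimately show ?thesis using derangement_5_cases[OF s] c by metis
  qed
  then obtain n where n: "s = Transposition.transpose n (s n)" by blast
  have "\<not> {1..5::nat} \<subseteq> {n, s n}"
    using card_mono[of "{n, s n}" "{1..5::nat}"] card_insert_le_m1[of 2 "{s n}" n] by auto
  then obtain m where "m \<in> {1..5}" "m \<noteq> n" "m \<noteq> s n" by blast
  then show False using c n by (metis transpose_apply_other)
qed

text \<open>The cube of an even permutation is even, hence no transposition, which leaves the
  5-cycles.\<close>

lemma derangement_5:
  assumes s: "s permutes {1..5::nat}" and ev: "evenperm s" and ne: "\<And>n. n \<in> {1..5} \<Longrightarrow> s n \<noteq> n"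
  shows "s \<circ> s \<circ> s \<circ> s \<circ> s = id"
proof -
  have "permutation s" using s by (auto simp: permutation_permutes)
  then have "evenperm (s \<circ> s \<circ> s)" using ev by (metis evenperm_comp permutation_compose)
  then show ?thesis using derangement_5_cases[OF s ne] by (auto simp: evenperm_swap)
qed

lemma even_fixing_id:
  assumes s: "s permutes {1..5::nat}" and ev: "evenperm s" and f: "s 3 = 3" "s 4 = 4" "s 5 = 5"
  shows "s = id"
proof (rule ccontr)
  assume n: "s \<noteq> id"
  have i: "s n = s m \<longleftrightarrow> n = m" for n m using permutes_inj[OF s] by (simp add: inj_eq)
  have r: "s n \<in> {1,2,3,4,5}" if "n \<in> {1,2,3,4,5}" for n
    using permutes_in_image[OF s, of n] that by auto
  have r12: "s 1 \<in> {1,2}" "s 2 \<in> {1,2}"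
    using r[of 1] r[of 2] i[of 1 3] i[of 1 4] i[of 1 5] i[of 2 3] i[of 2 4] i[of 2 5] f by auto
  have out: "s n = n" if "n \<noteq> 1" "n \<noteq> 2" for n
  proof (cases "n \<in> {1..5}")
    case True then have "n \<in> {3,4,5}" using that by auto
    then show ?thesis using f by auto
  qed (use permutes_not_in[OF s] in auto)
  have "s 1 \<noteq> 1 \<or> s 2 \<noteq> 2" using n out by (metis eq_id_iff)
  moreover have "s 1 \<noteq> s 2" using i by simp
  ultimately have "s 1 = 2" "s 2 = 1" using r12 by auto
  then have "s = Transposition.transpose 1 2"
    using out by (auto simp: fun_eq_iff Transposition.transpose_def)
  then show False using ev by (simp add: evenperm_swap)
qed

text \<open>A stabilizer chain: multiplying by elements of \<open>S\<close> makes the permutation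
  fix 5, then 4, then 3, and an even permutation fixing these three points is the identity.\<close>

lemma alt_5_generation:
  assumes comp: "\<And>s t. s \<in> S \<Longrightarrow> t \<in> S \<Longrightarrow> s \<circ> t \<in> S"
    and inv: "\<And>s. s \<in> S \<Longrightarrow> Hilbert_Choice.inv s \<in> S"
    and S: "\<And>s. s \<in> S \<Longrightarrow> s permutes {1..5::nat} \<and> evenperm s"
    and g: "id \<in> S" "Transposition.transpose 1 3 \<circ> Transposition.transpose 2 4 \<in> S" (is "?i \<in> S")
     "Transposition.transpose 1 2 \<circ> Transposition.transpose 2 3 \<in> S" (is "?o \<in> S")
     "Transposition.transpose 3 5 \<circ> Transposition.transpose 2 4 \<in> S" (is "?x \<in> S")
    and s: "s permutes {1..5}" "evenperm s"
  shows "s \<in> S"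
proof -
  \<comment> \<open>\<open>?o\<close> is a 3-cycle, so \<open>?j\<close> and \<open>?k\<close> are
    its conjugates of \<open>?i\<close>; the three are the involutions of a Klein four-group
    transitive on 1 to 4, and \<open>?x\<close> then links 3 with 5.\<close>
  let ?j = "?o \<circ> ?i \<circ> ?o \<circ> ?o"
  let ?k = "?o \<circ> ?o \<circ> ?i \<circ> ?o"
  have jk: "?j \<in> S" "?k \<in> S" using comp g by blast+
  have in5: "t m \<in> {1,2,3,4,5}" if "t permutes {1..5}" "m \<in> {1,2,3,4,5}" for t :: "nat \<Rightarrow> nat" and m
    using permutes_in_image[OF that(1), of m] that(2) by auto
  have step: "t \<circ> s permutes {1..5} \<and> evenperm (t \<circ> s)" if "t \<in> S" "s permutes {1..5}" "evenperm s" for t s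
    using S[OF that(1)] that permutes_compose evenperm_comp
    by (metis finite_atLeastAtMost permutation_permutes)
  have cancel: "s \<in> S" if "t \<in> S" "t \<circ> s \<in> S" for t s
  proof -
    have "Hilbert_Choice.inv t \<circ> (t \<circ> s) \<in> S" using comp inv that by blast
    then show ?thesis using S[OF that(1)] by (metis comp_assoc id_comp permutes_inv_o(2))
  qed
  have "s 5 \<in> {1,2,3,4,5}" using in5[OF s(1)] by simp
  then have "\<exists>t\<in>S. (t \<circ> s) 5 = 5"
  proof (elim insertE emptyE)
    assume "s 5 = 1" then show ?thesis using comp[OF g(4) g(2)]
      by (intro bexI[of _ "?x \<circ> ?i"]) (auto simp: Transposition.transpose_def)
  next
    assume "s 5 = 2" then show ?thesis using comp[OF g(4) jk(2)]
      by (intro bexI[of _ "?x \<circ> ?k"]) (auto simp: Transposition.transpose_def)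
  next
    assume "s 5 = 3" then show ?thesis using g(4)
      by (intro bexI[of _ "?x"]) (auto simp: Transposition.transpose_def)
  next
    assume "s 5 = 4" then show ?thesis using comp[OF g(4) jk(1)]
      by (intro bexI[of _ "?x \<circ> ?j"]) (auto simp: Transposition.transpose_def)
  next
    assume "s 5 = 5" then show ?thesis using g(1) by (intro bexI[of _ id]) auto
  qed
  then obtain t1 where t1: "t1 \<in> S" "(t1 \<circ> s) 5 = 5" by blast
  define s1 where "s1 = t1 \<circ> s"
  have s1: "s1 permutes {1..5}" "evenperm s1" "s1 5 = 5" using t1 step[OF t1(1) s] by (auto simp: s1_def)
  have inj1: "s1 a = s1 b \<longleftrightarrow> a = b" for a b using permutes_inj[OF s1(1)] by (simp add: inj_eq)
  have "s1 4 \<in> {1,2,3,4}" using in5[OF s1(1), of 4] s1(3) inj1[of 4 5] by auto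
  then have "\<exists>t\<in>S. (t \<circ> s1) 5 = 5 \<and> (t \<circ> s1) 4 = 4"
  proof (elim insertE emptyE)
    assume "s1 4 = 1" then show ?thesis using jk s1
      by (intro bexI[of _ "?k"]) (auto simp: Transposition.transpose_def)
  next
    assume "s1 4 = 2" then show ?thesis using g s1
      by (intro bexI[of _ "?i"]) (auto simp: Transposition.transpose_def)
  next
    assume "s1 4 = 3" then show ?thesis using jk s1
      by (intro bexI[of _ "?j"]) (auto simp: Transposition.transpose_def)
  next
    assume "s1 4 = 4" then show ?thesis using g(1) s1 by (intro bexI[of _ id]) auto
  qed
  then obtain t2 where t2: "t2 \<in> S" "(t2 \<circ> s1) 5 = 5" "(t2 \<circ> s1) 4 = 4" by blast
  define s2 where "s2 = t2 \<circ> s1"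
  have s2: "s2 permutes {1..5}" "evenperm s2" "s2 5 = 5" "s2 4 = 4"
    using t2 step[OF t2(1) s1(1,2)] by (auto simp: s2_def)
  have inj2: "s2 a = s2 b \<longleftrightarrow> a = b" for a b using permutes_inj[OF s2(1)] by (simp add: inj_eq)
  have "s2 3 \<in> {1,2,3}" using in5[OF s2(1), of 3] s2(3,4) inj2[of 3 5] inj2[of 3 4] by auto
  then have "\<exists>t\<in>S. (t \<circ> s2) 5 = 5 \<and> (t \<circ> s2) 4 = 4 \<and> (t \<circ> s2) 3 = 3"
  proof (elim insertE emptyE)
    assume "s2 3 = 1" then show ?thesis using comp[OF g(3) g(3)] s2
      by (intro bexI[of _ "?o \<circ> ?o"]) (auto simp: Transposition.transpose_def)
  next
    assume "s2 3 = 2" then show ?thesis using g s2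
      by (intro bexI[of _ "?o"]) (auto simp: Transposition.transpose_def)
  next
    assume "s2 3 = 3" then show ?thesis using g(1) s2 by (intro bexI[of _ id]) auto
  qed
  then obtain t3 where t3: "t3 \<in> S" "(t3 \<circ> s2) 5 = 5" "(t3 \<circ> s2) 4 = 4" "(t3 \<circ> s2) 3 = 3" by blast
  have "t3 \<circ> s2 = id"
    using even_fixing_id[of "t3 \<circ> s2"] t3 step[OF t3(1) s2(1,2)] by auto
  then have "t3 \<circ> s2 \<in> S" using g(1) by simp
  then show ?thesis using cancel t1(1) t2(1) t3(1) unfolding s1_def s2_def by blast
qed

section \<open>The binary icosahedral group\<close>

lemma conj_by_add: "conj_by h (u + v) = conj_by h u + conj_by h v"
  by (simp add: conj_by_def algebra_simps)

lemma qre_conj_by: "qnorm h = 1 \<Longrightarrow> qre (conj_by h x) = qre x"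
proof -
  assume h: "qnorm h = 1"
  have "qre (h * x * qcnj h) = qnorm h * qre x" by (simp add: qnorm_def algebra_simps)
  then show ?thesis using h by (simp add: conj_by_def)
qed

lemma qnorm_conj_by: "qnorm h = 1 \<Longrightarrow> qnorm (conj_by h x) = qnorm x"
  by (simp add: conj_by_def mult.commute)

lemma conj_by_prod: "qnorm h = 1 \<Longrightarrow> conj_by h (x * y) = conj_by h x * conj_by h y"
  by (simp add: conj_by_def mult.assoc unit_qcnj)

context golden begin

definition "kk = Quat 0 0 0 (1::'k)"

lemma jj_stab: "jj \<in> stab f (Transposition.transpose 1 2 \<circ> Transposition.transpose 3 4)"
  unfolding stab_def atLeastAtMost_1_5
  by (simp add: jj_def qnorm_def frame_def conj_by_def quat_eq_iff Transposition.transpose_def)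
    (auto simp add: uminus_quat_def times_quat_def)

lemma kk_stab: "kk \<in> stab f (Transposition.transpose 1 4 \<circ> Transposition.transpose 2 3)"
  unfolding stab_def atLeastAtMost_1_5
  by (simp add: kk_def qnorm_def frame_def conj_by_def quat_eq_iff Transposition.transpose_def)
    (auto simp add: uminus_quat_def times_quat_def)

lemma ijk_simps [simp]:
  "ii * ii = - 1" "jj * jj = - 1" "kk * kk = - 1" "ii * jj = kk" "jj * kk = ii" "kk * ii = jj"
  "jj * ii = - kk" "kk * jj = - ii" "ii * kk = - jj"
  "qcnj ii = - ii" "qcnj jj = - jj" "qcnj kk = - kk" "qnorm ii = 1" "qnorm jj = 1" "qnorm kk = 1"
  "qre ii = 0" "qre jj = 0" "qre kk = 0"
  by (simp_all add: quat_eq_iff ii_def jj_def kk_def qnorm_def)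

lemma neg_eq_iff [simp]: "x = - x \<longleftrightarrow> x = (0::'k)" "- x = x \<longleftrightarrow> x = (0::'k)"
proof -
  have "x + x = x * 2" by simp
  then have *: "x + x = 0 \<longleftrightarrow> x = 0" using two by (simp only: mult_eq_0_iff) simp
  show "x = - x \<longleftrightarrow> x = 0" using * by (metis add.right_inverse minus_zero)
  then show "- x = x \<longleftrightarrow> x = 0" by metis
qed

lemma add_self_eq_iff: "x + x = y + y \<longleftrightarrow> x = (y::'k)"
proof -
  have "x + x = y + y \<longleftrightarrow> x * 2 = y * 2" by simp
  then show ?thesis using two by (simp only: mult_cancel_right) simp
qed

lemma quat_add_self_eq_iff: "x + x = y + y \<longleftrightarrow> x = (y::'k quat)"
  by (simp only: quat_eq_iff quat_sel add_self_eq_iff)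

lemma stab_qnorm: "h \<in> stab f s \<Longrightarrow> qnorm h = 1"
  by (simp add: stab_def)

lemma stab_mult:
  assumes "g \<in> stab f s" "h \<in> stab f t" "t permutes {1..5}"
  shows "g * h \<in> stab f (s \<circ> t)"
  using assms permutes_in_image[OF assms(3)]
  unfolding stab_def conj_by_image_mult by (auto simp: conj_by_image_mult simp del: atLeastAtMost_iff)

lemma stab_qcnj:
  assumes "h \<in> stab f s" "s permutes {1..5}"
  shows "qcnj h \<in> stab f (Hilbert_Choice.inv s)"
proof -
  have "conj_by (qcnj h) ` frame f n = frame f (Hilbert_Choice.inv s n)" if n: "n \<in> {1..5}" for n
  proof -
    define m where "m = Hilbert_Choice.inv s n"
    have m: "m \<in> {1..5}" "s m = n"
      using n permutes_in_image[OF permutes_inv[OF assms(2)]] permutes_inverses[OF assms(2)]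
      by (auto simp: m_def simp del: atLeastAtMost_iff)
    then have "frame f n = conj_by h ` frame f m" using assms(1) by (auto simp: stab_def)
    then show ?thesis using stab_qnorm[OF assms(1)]
      by (simp add: image_image conj_by_qcnj flip: m_def)
  qed
  then show ?thesis using assms(1) by (simp add: stab_def)
qed

lemma stab_unique:
  assumes "h \<in> stab f s" "h \<in> stab f t" "s permutes {1..5}" "t permutes {1..5}"
  shows "s = t"
proof
  fix n show "s n = t n"
  proof (cases "n \<in> {1..5}")
    case True
    then have "frame f (s n) = frame f (t n)" using assms(1,2) by (auto simp: stab_def)
    then show ?thesis using True permutes_in_image[OF assms(3)] permutes_in_image[OF assms(4)]
      by (meson inj_frame inj_onD)
  qed (use assms permutes_not_in in metis)
qed

lemma stab_uminus [simp]: "- h \<in> stab f s \<longleftrightarrow> h \<in> stab f s"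
  by (simp add: stab_def)

lemma one_stab: "1 \<in> stab f id"
  by (simp add: stab_def)

text \<open>Each condition kills two of the four coordinates, and together they leave just
  one.\<close>

lemma commute_frame_scalar:
  assumes "m * ii = ii * m \<or> m * ii = - (ii * m)" "m * jj = jj * m \<or> m * jj = - (jj * m)"
  obtains a q where "m = scalar a * q" "q \<in> {1, ii, jj, kk}"
proof -
  obtain a b c d where m: "m = Quat a b c d" by (cases m)
  have "m \<in> {Quat a 0 0 0, Quat 0 b 0 0, Quat 0 0 c 0, Quat 0 0 0 d}"
    using assms unfolding m by (auto simp: quat_eq_iff ii_def jj_def)
  then have "m \<in> {scalar a * 1, scalar b * ii, scalar c * jj, scalar d * kk}"
    by (simp add: scalar_def ii_def jj_def kk_def times_quat_def)
  then show ?thesis using that by blast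
qed

text \<open>Up to a scalar \<open>1 + ii\<close> is the quarter-turn about \<open>ii\<close> that
  takes \<open>jj\<close> to \<open>kk\<close>; any other such \<open>m\<close> differs from it by a
  half-turn about an axis.\<close>

lemma swap_frame_scalar:
  assumes "m * ii = ii * m \<or> m * ii = - (ii * m)" "m * jj = kk * m \<or> m * jj = - (kk * m)"
  obtains a q where "m = scalar a * ((1 + ii) * q)" "q \<in> {1, ii, jj, kk}"
proof -
  obtain a b c d where m: "m = Quat a b c d" by (cases m)
  have "m \<in> {Quat a a 0 0, Quat a (-a) 0 0, Quat 0 0 c c, Quat 0 0 c (-c)}"
    using assms unfolding m by (auto simp: quat_eq_iff ii_def jj_def kk_def)
  then have "m \<in> {scalar a * ((1+ii) * 1), scalar (-a) * ((1+ii) * ii), scalar c * ((1+ii)*jj), scalar (-c) * ((1+ii)*kk)}"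
    by (auto simp add: scalar_def ii_def jj_def kk_def times_quat_def plus_quat_def one_quat_def)
  then show ?thesis using that by blast
qed

lemma norm_one_scalar:
  assumes "m = scalar a * q" "q \<in> {1, ii, jj, kk}" "qnorm m = 1"
  shows "m \<in> {1, -1, ii, -ii, jj, -jj, kk, -kk}"
proof -
  have "a * a = 1" using assms by auto
  then have "a = 1 \<or> a = - 1" by (simp add: square_eq_1_iff)
  then show ?thesis using assms by (auto simp: scalar_hom)
qed

definition "axes = {ii, -ii, jj, -jj, kk, -kk}"

lemma frame5_axes:
  assumes "conj_by h ` frame f 5 = frame f 5"
  shows "conj_by h ii \<in> axes" "conj_by h jj \<in> axes"
proof -
  have fr: "frame f 5 = {ii+ii, jj+jj, kk+kk, -ii+-ii, -jj+-jj, -kk+-kk}"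
    by (auto simp: frame_def ii_def jj_def kk_def plus_quat_def uminus_quat_def)
  have "conj_by h v \<in> axes" if "v + v \<in> frame f 5" for v
  proof -
    have "conj_by h v + conj_by h v \<in> frame f 5"
      using assms that conj_by_add[of h v v] by (metis imageI)
    then show ?thesis unfolding fr axes_def by (simp only: insert_iff empty_iff quat_add_self_eq_iff) blast
  qed
  then show "conj_by h ii \<in> axes" "conj_by h jj \<in> axes" unfolding fr by simp_all
qed

lemma conj_by_eqD: "qnorm h = 1 \<Longrightarrow> conj_by h x = y \<Longrightarrow> h * x = y * h"
  by (auto simp: conj_by_def mult.assoc unit_qcnj)

lemma ijk_perm:
  "Transposition.transpose 1 3 \<circ> Transposition.transpose 2 4 permutes {1..5::nat}"
  "Transposition.transpose 1 2 \<circ> Transposition.transpose 3 4 permutes {1..5::nat}"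
  "Transposition.transpose 1 4 \<circ> Transposition.transpose 2 3 permutes {1..5::nat}"
  "Transposition.transpose 1 2 \<circ> Transposition.transpose 2 3 permutes {1..5::nat}"
  "Transposition.transpose 3 5 \<circ> Transposition.transpose 2 4 permutes {1..5::nat}"
  by (intro permutes_compose permutes_swap_id; simp)+

lemma ijk_not_stab_id: "ii \<notin> stab f id" "jj \<notin> stab f id" "kk \<notin> stab f id"
proof -
  have "s \<noteq> id" if "s 1 \<noteq> 1" for s :: "nat \<Rightarrow> nat" using that by auto
  then show "ii \<notin> stab f id" "jj \<notin> stab f id" "kk \<notin> stab f id"
    using stab_unique[OF ii_stab _ ijk_perm(1) permutes_id]
      stab_unique[OF jj_stab _ ijk_perm(2) permutes_id] stab_unique[OF kk_stab _ ijk_perm(3) permutes_id]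
    by (auto simp: fun_eq_iff Transposition.transpose_def split: if_splits)
qed

text \<open>The kernel of the action on frames. For \<open>h\<close> in it, the commutator with
  \<open>ii\<close> is again in it; since \<open>h\<close> sends \<open>ii\<close> to an axis, this
  commutator is a sign or an axis, and axes move frames. So \<open>h\<close> fixes \<open>ii\<close>
  up to sign, likewise \<open>jj\<close>, and is a scalar or an axis, of which only the signs
  survive.\<close>

lemma stab_id: "stab f id = {1, -1}"
proof (intro equalityI subsetI)
  fix h assume h: "h \<in> stab f id"
  have n: "qnorm h = 1" using h by (rule stab_qnorm)
  have comm: "conj_by h v * qcnj v \<in> stab f id" if "v \<in> stab f s" "s permutes {1..5}" for v s
  proof -
    have "h * v * (qcnj h * qcnj v) \<in> stab f ((id \<circ> s) \<circ> (Hilbert_Choice.inv id \<circ> Hilbert_Choice.inv s))"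
      by (intro stab_mult stab_qcnj h that permutes_id permutes_inv permutes_compose)
    then show ?thesis using permutes_inv_o(1)[OF that(2)]
      by (simp add: conj_by_def mult.assoc inv_id)
  qed
  have "frame f 5 = conj_by h ` frame f 5" using h by (auto simp: stab_def)
  note ax = frame5_axes[OF this[symmetric]]
  have "conj_by h ii \<in> {ii, -ii}" "conj_by h jj \<in> {jj, -jj}"
    using ax comm[OF ii_stab ijk_perm(1)] comm[OF jj_stab ijk_perm(2)] ijk_not_stab_id
    unfolding axes_def by auto
  then have "h * ii = ii * h \<or> h * ii = - (ii * h)" "h * jj = jj * h \<or> h * jj = - (jj * h)"
    using conj_by_eqD[OF n] by auto
  then obtain a q where "h = scalar a * q" "q \<in> {1, ii, jj, kk}" by (rule commute_frame_scalar)
  from norm_one_scalar[OF this n] show "h \<in> {1, -1}" using h ijk_not_stab_id by auto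
qed (auto simp: one_stab)

definition alt5 where "alt5 = {s. s permutes {1..5::nat} \<and> evenperm s}"

lemma alt5_comp: "s \<in> alt5 \<Longrightarrow> t \<in> alt5 \<Longrightarrow> s \<circ> t \<in> alt5"
  unfolding alt5_def using evenperm_comp permutes_compose
  by (metis (mono_tags, lifting) finite_atLeastAtMost mem_Collect_eq permutation_permutes)

lemma alt5_inv: "s \<in> alt5 \<Longrightarrow> Hilbert_Choice.inv s \<in> alt5"
  unfolding alt5_def using evenperm_inv permutes_inv
  by (metis (mono_tags, lifting) finite_atLeastAtMost mem_Collect_eq permutation_permutes)

lemma alt5_gens:
  "id \<in> alt5" "Transposition.transpose 1 3 \<circ> Transposition.transpose 2 4 \<in> alt5"
  "Transposition.transpose 1 2 \<circ> Transposition.transpose 3 4 \<in> alt5"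
  "Transposition.transpose 1 4 \<circ> Transposition.transpose 2 3 \<in> alt5"
  "Transposition.transpose 1 2 \<circ> Transposition.transpose 2 3 \<in> alt5"
  "Transposition.transpose 3 5 \<circ> Transposition.transpose 2 4 \<in> alt5"
  using ijk_perm by (auto simp: alt5_def evenperm_comp evenperm_swap permutes_id permutation_swap_id)

text \<open>The action on frames is onto A5, because the permutations that are realised form a
  subgroup containing the generators.\<close>

lemma stab_nonempty:
  assumes "s \<in> alt5"
  shows "stab f s \<noteq> {}"
proof -
  let ?S = "{s \<in> alt5. stab f s \<noteq> {}}"
  have "s \<in> ?S"
  proof (rule alt_5_generation)
    fix s t assume "s \<in> ?S" "t \<in> ?S"
    then show "s \<circ> t \<in> ?S" using alt5_comp stab_mult by (fastforce simp: alt5_def)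
  next
    fix s assume "s \<in> ?S"
    then show "Hilbert_Choice.inv s \<in> ?S" using alt5_inv stab_qcnj by (fastforce simp: alt5_def)
  next
    show "id \<in> ?S" using one_stab alt5_gens by auto
    show "Transposition.transpose 1 3 \<circ> Transposition.transpose 2 4 \<in> ?S"
      using ii_stab alt5_gens by auto
    show "Transposition.transpose 1 2 \<circ> Transposition.transpose 2 3 \<in> ?S"
      using om_stab alt5_gens by auto
    show "Transposition.transpose 3 5 \<circ> Transposition.transpose 2 4 \<in> ?S"
      using xx_stab alt5_gens by auto
  qed (use assms in \<open>auto simp: alt5_def\<close>)
  then show ?thesis by simp
qed

text \<open>The binary icosahedral group. Its elements are not listed: closure and orders are read
  off from the permutations.\<close>

definition "icos = (\<Union>s\<in>alt5. stab f s)"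

lemma icosI: "h \<in> stab f s \<Longrightarrow> s \<in> alt5 \<Longrightarrow> h \<in> icos" by (auto simp: icos_def)

lemma icos_closed:
  "1 \<in> icos" "g \<in> icos \<Longrightarrow> h \<in> icos \<Longrightarrow> g * h \<in> icos" "h \<in> icos \<Longrightarrow> qcnj h \<in> icos"
  "- h \<in> icos \<longleftrightarrow> h \<in> icos" "h \<in> icos \<Longrightarrow> qnorm h = 1"
  "g \<in> icos \<Longrightarrow> h \<in> icos \<Longrightarrow> conj_by g h \<in> icos"
proof -
  show "1 \<in> icos" using icosI one_stab alt5_gens(1) .
  show *: "g \<in> icos \<Longrightarrow> h \<in> icos \<Longrightarrow> g * h \<in> icos" for g h
    using stab_mult alt5_comp by (fastforce simp: icos_def alt5_def)
  show **: "h \<in> icos \<Longrightarrow> qcnj h \<in> icos" for h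
    using stab_qcnj alt5_inv by (fastforce simp: icos_def alt5_def)
  show "- h \<in> icos \<longleftrightarrow> h \<in> icos" "h \<in> icos \<Longrightarrow> qnorm h = 1"
    by (auto simp: icos_def stab_qnorm)
  show "g \<in> icos \<Longrightarrow> h \<in> icos \<Longrightarrow> conj_by g h \<in> icos" using * ** by (simp add: conj_by_def)
qed

lemma icos_gens: "ii \<in> icos" "jj \<in> icos" "kk \<in> icos" "om \<in> icos" "xx \<in> icos"
  using icosI ii_stab jj_stab kk_stab om_stab xx_stab alt5_gens by metis+

lemma reach_frame5:
  assumes "e \<in> {1..5}"
  obtains g t where "g \<in> stab f t" "t \<in> alt5" "t e = 5"
proof -
  have xi: "xx * h \<in> stab f ((Transposition.transpose 3 5 \<circ> Transposition.transpose 2 4) \<circ> t)"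
    "(Transposition.transpose 3 5 \<circ> Transposition.transpose 2 4) \<circ> t \<in> alt5"
    if "h \<in> stab f t" "t \<in> alt5" for h t
    using stab_mult[OF xx_stab that(1)] alt5_comp[OF alt5_gens(6)] that(2) by (auto simp: alt5_def)
  have "e \<in> {1,2,3,4,5}" using assms by auto
  then show ?thesis
  proof (elim insertE emptyE)
    assume "e = 1" then show ?thesis
      using that[OF xi[OF ii_stab alt5_gens(2)]] by (simp add: Transposition.transpose_def)
  next
    assume "e = 2" then show ?thesis
      using that[OF xi[OF kk_stab alt5_gens(4)]] by (simp add: Transposition.transpose_def)
  next
    assume "e = 3" then show ?thesis
      using that[OF xi[OF one_stab alt5_gens(1)]] by (simp add: Transposition.transpose_def)
  next
    assume "e = 4" then show ?thesis
      using that[OF xi[OF jj_stab alt5_gens(3)]] by (simp add: Transposition.transpose_def)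
  next
    assume "e = 5" then show ?thesis using that[OF one_stab alt5_gens(1)] by simp
  qed
qed

end

section \<open>Traces in the binary icosahedral group\<close>

locale icosahedral = golden f for f :: "'k::field" +
  assumes nonsq: "\<And>s::'k. s * s \<noteq> 2" "\<And>s::'k. s * s \<noteq> 3" "\<And>s. s * s \<noteq> f + 2" "\<And>s. s * s \<noteq> 3 - f"
begin

lemma three: "(3::'k) \<noteq> 0" using nonsq(2)[of 0] by simp

lemma five: "(5::'k) \<noteq> 0"
proof
  assume 5: "(5::'k) = 0"
  \<comment> \<open>In characteristic 5 the nonsquare \<open>f + 2\<close> would vanish.\<close>
  have "(f + 2) * (f + 2) = 5 * f + 5" by (simp add: algebra_simps ff)
  then have "f + 2 = 0" using 5 by simp
  then show False using nonsq(3)[of 0] by simp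
qed

text \<open>Excludes scaling \<open>1 + ii\<close> to norm 1, which would admit
  quarter-turns.\<close>

lemma not_half_norm: "2 * (x * x) \<noteq> (1::'k)"
proof
  assume x: "2 * (x * x) = 1"
  have "(2 * x) * (2 * x) = 2 * (2 * (x * x))" by simp
  then show False using x nonsq(1)[of "2 * x"] by simp
qed

text \<open>Together with \<open>{1, - 1} \<union> axes\<close> these are the 24 Hurwitz units.\<close>

definition "hurwitz = {Quat a b c d |a b c d. {a, b, c, d} \<subseteq> {1/2, - 1/2 :: 'k}}"

text \<open>Unit quaternions permuting the axes up to sign form at most a binary octahedral group.
  Its elements beyond the 24 Hurwitz units have two equal coordinates up to sign and two zeros, so
  their norm is \<open>2 * (x * x)\<close>, which is never 1.\<close>

lemma axes_stab:
  assumes n: "qnorm h = 1" and ax: "conj_by h ii \<in> axes" "conj_by h jj \<in> axes"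
  shows "h \<in> {1, -1} \<union> axes \<or>
    h \<in> hurwitz"
proof -
  obtain a b c d where h: "h = Quat a b c d" by (cases h)
  have norm: "a * a + b * b + c * c + d * d = 1" using n by (simp add: h qnorm_def)
  have v: "h * ii \<in> {ii * h, -(ii * h), jj * h, -(jj * h), kk * h, -(kk * h)}"
    and w: "h * jj \<in> {ii * h, -(ii * h), jj * h, -(jj * h), kk * h, -(kk * h)}"
    using ax conj_by_eqD[OF n] unfolding axes_def by fastforce+
  let ?p = "\<lambda>x y. h * x = y * h \<or> h * x = - (y * h)"
  have v: "?p ii ii \<or> ?p ii jj \<or> ?p ii kk" and w: "?p jj ii \<or> ?p jj jj \<or> ?p jj kk"
    using v w by (simp_all only: insert_iff empty_iff) argo+
  have comp: "h * ii = Quat (- b) a d (- c)" "h * jj = Quat (- c) (- d) a b"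
    "ii * h = Quat (- b) a (- d) c" "jj * h = Quat (- c) d a (- b)" "kk * h = Quat (- d) (- c) b a"
    by (simp_all add: h ii_def jj_def kk_def times_quat_def)
  have neg: "- Quat p q r t = Quat (- p) (- q) (- r) (- t)" for p q r t :: 'k
    by (simp add: uminus_quat_def)
  have e: "?p ii ii \<Longrightarrow> (c = 0 \<and> d = 0) \<or> (a = 0 \<and> b = 0)"
    "?p jj jj \<Longrightarrow> (b = 0 \<and> d = 0) \<or> (a = 0 \<and> c = 0)"
    "?p ii jj \<Longrightarrow> (b = c \<and> a = d) \<or> (b = - c \<and> a = - d)"
    "?p ii kk \<Longrightarrow> (b = d \<and> a = - c) \<or> (b = - d \<and> a = c)"
    "?p jj ii \<Longrightarrow> (c = b \<and> d = - a) \<or> (c = - b \<and> d = a)"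
    "?p jj kk \<Longrightarrow> (c = d \<and> a = b) \<or> (c = - d \<and> a = - b)"
    unfolding comp neg quat.inject by (metis minus_minus neg_eq_iff)+
  \<comment> \<open>\<open>S\<close> disposes of the cases where exactly two axes are swapped,
    \<open>Z\<close> of those where two axes would have the same image. What remains is no
    permutation of the axes (\<open>D\<close>) or a cyclic one (\<open>T\<close>).\<close>
  have S: thesis if "x * x + x * x = a * a + b * b + c * c + d * d" for x thesis
    using that norm not_half_norm[of x] by simp
  have Z: thesis if "a = 0 \<and> b = 0 \<and> c = 0 \<and> d = 0" for thesis
    using norm that by simp
  consider (D) "?p ii ii" "?p jj jj" | (T) "b = a \<or> b = -a" "c = a \<or> c = - a" "d = a \<or> d = -a"
    using v
  proof (elim disjE[of "?p ii ii"] disjE[of "?p ii jj"])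
    assume v: "?p ii ii"
    show thesis using w
    proof (elim disjE[of "?p jj ii"] disjE[of "?p jj jj"])
      assume w: "?p jj ii"
      show thesis by (rule Z) (use e(1)[OF v] e(5)[OF w] in auto)
    next
      assume w: "?p jj jj"
      show thesis using D v w .
    next
      assume w: "?p jj kk"
      show thesis by (rule S[of "a + c"]) (use e(1)[OF v] e(6)[OF w] in auto)
    qed
  next
    assume v: "?p ii jj"
    show thesis using w
    proof (elim disjE[of "?p jj ii"] disjE[of "?p jj jj"])
      assume w: "?p jj ii"
      show thesis by (rule S[of "a + b"]) (use e(3)[OF v] e(5)[OF w] in auto)
    next
      assume w: "?p jj jj"
      show thesis by (rule Z) (use e(3)[OF v] e(2)[OF w] in auto)
    next
      assume w: "?p jj kk"
      show thesis by (rule T) (use e(3)[OF v] e(6)[OF w] in auto)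
    qed
  next
    assume v: "?p ii kk"
    show thesis using w
    proof (elim disjE[of "?p jj ii"] disjE[of "?p jj jj"])
      assume w: "?p jj ii"
      show thesis by (rule T) (use e(4)[OF v] e(5)[OF w] in auto)
    next
      assume w: "?p jj jj"
      show thesis by (rule S[of "a + b"]) (use e(4)[OF v] e(2)[OF w] in auto)
    next
      assume w: "?p jj kk"
      show thesis by (rule Z) (use e(4)[OF v] e(6)[OF w] in auto)
    qed
  qed
  then show ?thesis
  proof cases
    case D
    then obtain a q where "h = scalar a * q" "q \<in> {1, ii, jj, kk}" by (rule commute_frame_scalar)
    from norm_one_scalar[OF this n] show ?thesis by (auto simp: axes_def)
  next
    case T
    then have "4 * (a * a) = 1" unfolding norm[symmetric] by auto
    then have "(2 * a) * (2 * a) = 1" by simp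
    then have "2 * a = 1 \<or> 2 * a = - 1" by (simp only: square_eq_1_iff)
    then have "a = 1/2 \<or> a = -1/2" using two by (auto simp: field_simps)
    then have "h \<in> hurwitz" using T unfolding h hurwitz_def by (auto simp del: minus_divide_left)
    then show ?thesis by blast
  qed
qed

lemma icos_frame5:
  assumes "h \<in> stab f s" "s 5 = 5"
  shows "h \<in> {1, -1} \<union> axes \<or>
    h \<in> hurwitz"
  using assms by (intro axes_stab frame5_axes) (auto simp: stab_def)

lemma icos_conj_to_frame5:
  assumes "h \<in> stab f s" "s \<in> alt5" "s e = e" "e \<in> {1..5::nat}"
  obtains g where "g \<in> icos" "conj_by g h \<in> icos"
    "conj_by g h \<in> {1, -1} \<union> axes \<or>
    conj_by g h \<in> hurwitz"
proof -
  obtain g t where g: "g \<in> stab f t" "t \<in> alt5" "t e = 5" using reach_frame5[OF assms(4)] .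
  have p: "t permutes {1..5}" "s permutes {1..5}" using g(2) assms(2) by (auto simp: alt5_def)
  have "conj_by g h \<in> stab f ((t \<circ> s) \<circ> Hilbert_Choice.inv t)"
    unfolding conj_by_def by (intro stab_mult stab_qcnj g assms p permutes_inv)
  moreover have "((t \<circ> s) \<circ> Hilbert_Choice.inv t) 5 = 5"
    using g(3) assms(3) p permutes_inverses(2)[OF p(1), of e] by simp
  moreover have "g \<in> icos" "h \<in> icos" using icosI g assms by metis+
  ultimately show ?thesis using that icos_frame5 icos_closed(6) by metis
qed

lemma axes_re [simp]: "x \<in> axes \<Longrightarrow> qre x = 0"
  by (auto simp: axes_def)

lemma re_one_scalar:
  fixes h :: "'k quat"
  assumes "qnorm h = 1" "qi h = 0" "qj h = 0" "qk h = 0"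
  shows "h = 1 \<or> h = - 1"
proof -
  have "qre h * qre h = 1" using assms by (simp add: qnorm_def)
  then have "qre h = 1 \<or> qre h = - 1" by (simp only: square_eq_1_iff)
  then show ?thesis using assms by (auto simp: quat_eq_iff)
qed

lemma hurwitz_re: "x \<in> hurwitz \<Longrightarrow> 2 * qre x \<in> {1, - 1}"
proof -
  assume "x \<in> hurwitz"
  then have "qre x = 1/2 \<or> qre x = - 1/2" unfolding hurwitz_def by fastforce
  then show ?thesis using two by (elim disjE) (simp_all add: mult.commute)
qed

text \<open>If some frame is fixed, \<open>h\<close> is conjugate to a Hurwitz unit, of trace 0 or
  \<plusminus>1 unless central. Otherwise it induces a 5-cycle, so its fifth power is a sign and its
  trace is a root of a quartic.\<close>

lemma icos_trace:
  assumes h: "h \<in> icos"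
  shows "h = 1 \<or> h = - 1 \<or> 2 * qre h \<in> {0, 1, - 1, f, - f, f - 1, 1 - f}"
proof -
  have n: "qnorm h = 1" using icos_closed(5) h .
  obtain s where s: "h \<in> stab f s" "s \<in> alt5" using h by (auto simp: icos_def)
  show ?thesis
  proof (cases "\<exists>e\<in>{1..5}. s e = e")
    case True
    then obtain g where g: "g \<in> icos" and
      c: "conj_by g h \<in> {1, -1} \<union> axes \<or>
    conj_by g h \<in> hurwitz"
      using icos_conj_to_frame5[OF s] by metis
    have gn: "qnorm g = 1" using icos_closed(5) g .
    have h': "h = conj_by (qcnj g) (conj_by g h)" using conj_by_qcnj[OF gn] by simp
    have re: "qre h = qre (conj_by g h)" using qre_conj_by[OF gn] by simp
    have "h = 1 \<or> h = -1" if "conj_by g h \<in> {1, -1}"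
      using that gn h' by (auto simp: conj_by_def unit_qcnj)
    then show ?thesis using c hurwitz_re unfolding re by auto
  next
    case False
    then have s5: "s \<circ> s \<circ> s \<circ> s \<circ> s = id" using derangement_5[of s] s(2) by (auto simp: alt5_def)
    have p: "s permutes {1..5}" using s(2) by (auto simp: alt5_def)
    have "h * h * h * h * h \<in> stab f (s \<circ> s \<circ> s \<circ> s \<circ> s)" by (intro stab_mult s p)
    then have h5: "h * h * h * h * h = 1 \<or> h * h * h * h * h = - 1" unfolding s5 stab_id by simp
    define t where "t = 2 * qre h"
    have sq: "h * h = scalar t * h - 1" using quat_square[of h] n by (simp add: t_def)
    have c: "h * scalar x = scalar x * h" "h * (scalar x * y) = scalar x * (h * y)" for x y
      using scalar_commute[of h x] by (simp_all flip: mult.assoc)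
    have h3: "h * h * h = scalar (t*t - 1) * h - scalar t"
      by (simp add: sq algebra_simps scalar_hom mult.assoc c)
    have "h * h * h * h * h = (h * h * h) * (h * h)" by (simp add: mult.assoc)
    also have "\<dots> = scalar (t*t*t*t - 3 * (t*t) + 1) * h - scalar (t*t*t - 2 * t)"
      unfolding h3 sq left_diff_distrib right_diff_distrib mult.assoc c sq
      by (simp add: quat_eq_iff algebra_simps)
    finally have eq: "h * h * h * h * h = scalar (t*t*t*t - 3 * (t*t) + 1) * h - scalar (t*t*t - 2 * t)" .
    \<comment> \<open>The Chebyshev polynomial in \<open>t\<close> that appears as coefficient of
      \<open>h\<close> in its fifth power. It vanishes unless \<open>h\<close> is a scalar, and its
      four roots are \<plusminus>\<open>f\<close> and \<plusminus>\<open>(f - 1)\<close>.\<close>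
    let ?u = "t*t*t*t - 3 * (t*t) + 1"
    have "?u * qi h = 0" "?u * qj h = 0" "?u * qk h = 0"
      using h5 unfolding eq by (auto simp: quat_eq_iff)
    then have "?u = 0 \<or> (qi h = 0 \<and> qj h = 0 \<and> qk h = 0)" by (metis mult_eq_0_iff)
    moreover have "?u = (t - f) * (t - (1 - f)) * ((t + f) * (t - (f - 1)))"
      by (simp add: algebra_simps ff fff)
    ultimately have "t \<in> {f, - f, f - 1, 1 - f} \<or> h = 1 \<or> h = - 1"
      using re_one_scalar[OF n] by (auto simp: add_eq_0_iff2)
    then show ?thesis by (auto simp: t_def)
  qed
qed

end

section \<open>Normalizers of nonsquare norm\<close>

definition qinv :: "'a::field quat \<Rightarrow> 'a quat" where "qinv n = scalar (1 / qnorm n) * qcnj n"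

lemma qinv:
  assumes "qnorm n \<noteq> 0"
  shows "n * qinv n = 1" "qinv n * n = 1" "n * (qinv n * x) = x" "qinv n * (n * x) = x"
proof -
  have "n * qinv n = scalar (1 / qnorm n) * (n * qcnj n)"
    by (simp add: qinv_def quat_eq_iff algebra_simps)
  then show 1: "n * qinv n = 1" using assms by (simp add: mult_qcnj flip: scalar_hom(4))
  show 2: "qinv n * n = 1"
    using assms by (simp add: qinv_def mult_qcnj mult.assoc flip: scalar_hom(4))
  show "n * (qinv n * x) = x" "qinv n * (n * x) = x" by (simp_all add: 1 2 flip: mult.assoc)
qed

lemma qinv_unit: "qnorm g = 1 \<Longrightarrow> qinv g = qcnj g"
  by (simp add: qinv_def)

lemma qinv_mult: "qinv (m * n) = qinv n * qinv m"
proof -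
  have *: "scalar (1 / (qnorm m * qnorm n)) = scalar (1 / qnorm n) * scalar (1 / qnorm m)"
    by (simp flip: scalar_hom(4))
  have "qinv (m * n) = scalar (1 / qnorm n) * ((scalar (1 / qnorm m) * qcnj n) * qcnj m)"
    by (simp only: qinv_def qnorm_mult qcnj_mult * mult.assoc)
  also have "\<dots> = qinv n * qinv m"
    unfolding scalar_commute[of "qcnj n" "1 / qnorm m", symmetric] qinv_def by (simp only: mult.assoc)
  finally show ?thesis .
qed

text \<open>Conjugation by any invertible element, insensitive to scaling \<open>n\<close> by a
  nonzero scalar; hence only the square class of the norm matters.\<close>

definition nconj :: "'a::field quat \<Rightarrow> 'a quat \<Rightarrow> 'a quat" where "nconj n x = n * x * qinv n"

lemma nconj_mult_left: "nconj (m * n) x = nconj m (nconj n x)"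
  by (simp add: nconj_def qinv_mult mult.assoc)

lemma nconj_unit: "qnorm g = 1 \<Longrightarrow> nconj g = conj_by g"
  by (simp add: nconj_def conj_by_def qinv_unit fun_eq_iff)

lemma nconj_eqI: "qnorm n \<noteq> 0 \<Longrightarrow> n * x = y * n \<Longrightarrow> nconj n x = y"
  by (simp add: nconj_def mult.assoc qinv)

lemma nconj_eqD: "qnorm n \<noteq> 0 \<Longrightarrow> nconj n x = y \<Longrightarrow> n * x = y * n"
  by (auto simp add: nconj_def mult.assoc qinv)

lemma nconj_mult: "qnorm n \<noteq> 0 \<Longrightarrow> nconj n (x * y) = nconj n x * nconj n y"
  by (simp add: nconj_def mult.assoc qinv)

lemma nconj_uminus: "nconj n (- x) = - nconj n x"
  by (simp add: nconj_def)

lemma qre_commute: "qre (x * y) = qre (y * x)"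
  by (simp add: algebra_simps)

lemma qre_nconj: "qnorm n \<noteq> 0 \<Longrightarrow> qre (nconj n x) = qre x"
  unfolding nconj_def qre_commute[of "n * x"] by (simp only: qinv not_False_eq_True)

lemma nconj_scalar: "a \<noteq> 0 \<Longrightarrow> nconj (scalar a) x = x"
  by (rule nconj_eqI) (simp_all add: scalar_commute)

section \<open>Elements normalizing the whole group\<close>

context icosahedral begin

text \<open>Trace zero means \<open>x * x = - 1\<close>, so \<open>x\<close> induces an involution
  or the identity on the frames and fixes one of them. It is then conjugate to an axis, and
  \<open>om\<close> permutes the axes cyclically.\<close>

lemma icos_trace0_conj:
  assumes x: "x \<in> icos" "qre x = 0"
  obtains g where "g \<in> icos" "conj_by g x \<in> {ii, - ii}"
proof -
  have n: "qnorm x = 1" using icos_closed(5) x(1) .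
  obtain s where s: "x \<in> stab f s" "s \<in> alt5" using x(1) by (auto simp: icos_def)
  have p: "s permutes {1..5}" using s by (simp add: alt5_def)
  have "x * x = - 1" using quat_square[of x] n x(2) by simp
  then have "- 1 \<in> stab f (s \<circ> s)" using stab_mult[OF s(1) s(1) p] by simp
  then have "s \<circ> s = id"
    using stab_unique one_stab permutes_id permutes_compose[OF p p] stab_uminus by metis
  from involution_5_fixpoint[OF p this] obtain e where e: "s e = e" "e \<in> {1..5}" by blast
  obtain g where g: "g \<in> icos" "conj_by g x \<in> {1, - 1} \<union> axes \<or> conj_by g x \<in> hurwitz"
    using icos_conj_to_frame5[OF s e] by metis
  have gn: "qnorm g = 1" using icos_closed(5) g(1) .
  have re: "qre (conj_by g x) = 0" using qre_conj_by[OF gn] x(2) by simp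
  then have "conj_by g x \<in> axes" using g(2) hurwitz_re[of "conj_by g x"] by auto
  moreover have "conj_by om jj = kk" "conj_by om kk = ii"
    by (simp_all add: jj_def kk_def ii_def conj_by_om)
  then have "conj_by g x \<in> {kk, - kk} \<Longrightarrow> conj_by (om * g) x \<in> {ii, - ii}"
    "conj_by g x \<in> {jj, - jj} \<Longrightarrow> conj_by (om * om * g) x \<in> {ii, - ii}"
    by (auto simp: conj_by_mult conj_by_uminus)
  moreover have "om * g \<in> icos" "om * om * g \<in> icos" using icos_closed(2) icos_gens(4) g(1) by blast+
  ultimately show ?thesis using that g(1) unfolding axes_def by blast
qed

text \<open>\<open>y\<close> conjugates \<open>ii\<close> to its negative, so its permutation
  commutes with that of \<open>ii\<close> and preserves the only fixed frame of the latter, the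
  standard one. Trace zero then leaves the axes.\<close>

lemma icos_anticommute:
  assumes y: "y \<in> icos" "qre y = 0" "y * ii = - (ii * y)"
  shows "y \<in> {jj, - jj, kk, - kk}"
proof -
  have n: "qnorm y = 1" using icos_closed(5) y(1) .
  obtain t where t: "y \<in> stab f t" "t \<in> alt5" using y(1) by (auto simp: icos_def)
  have p: "t permutes {1..5}" using t by (simp add: alt5_def)
  let ?p = "Transposition.transpose 1 3 \<circ> Transposition.transpose 2 4 :: nat \<Rightarrow> nat"
  have "conj_by y ii = - ii" using y(3) n by (simp add: conj_by_def unit_qcnj mult.assoc)
  moreover have "y * ii * qcnj y \<in> stab f ((t \<circ> ?p) \<circ> Hilbert_Choice.inv t)"
    by (intro stab_mult stab_qcnj t ii_stab p ijk_perm permutes_inv)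
  ultimately have "ii \<in> stab f ((t \<circ> ?p) \<circ> Hilbert_Choice.inv t)" by (simp add: conj_by_def)
  then have "(t \<circ> ?p) \<circ> Hilbert_Choice.inv t = ?p"
    by (rule stab_unique[OF _ ii_stab]) (intro permutes_compose permutes_inv p ijk_perm)+
  then have "((t \<circ> ?p) \<circ> Hilbert_Choice.inv t) (t 5) = ?p (t 5)" by simp
  then have "?p (t 5) = t 5"
    using permutes_inverses(2)[OF p, of 5] by (simp add: Transposition.transpose_def)
  moreover have "t 5 \<in> {1..5}" using permutes_in_image[OF p, of 5] by simp
  then have "t 5 \<in> {1,2,3,4,5}" by auto
  ultimately have "t 5 = 5" by (auto simp: Transposition.transpose_def)
  then have "y \<in> {1, - 1} \<union> axes \<or> y \<in> hurwitz" using icos_frame5 t(1) by metis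
  then have "y \<in> axes" using y(2) hurwitz_re[of y] by auto
  moreover have "(- 1 :: 'k quat) \<noteq> 1"
  proof
    assume "(- 1 :: 'k quat) = 1"
    then have "qre (- 1 :: 'k quat) = qre 1" by (simp only:)
    then show False using golden_neq by simp
  qed
  then have "y \<noteq> ii" "y \<noteq> - ii" using y(3) by auto
  ultimately show ?thesis by (simp add: axes_def)
qed

text \<open>
  Up to the group itself, a normalizing element fixes the standard frame and the axis \<open>ii\<close>, so it
  is a scalar or a scalar times \<open>1 + ii\<close>; but \<open>1 + ii\<close> does not normalize, as its conjugate of \<open>xx\<close>,
  multiplied by \<open>xx\<close>, has trace \<open>- 1/2\<close>.
\<close>

lemma icos_normalizer_norm:
  assumes n: "\<And>s. qnorm n \<noteq> s * s" and norm: "\<And>h. h \<in> icos \<Longrightarrow> nconj n h \<in> icos"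
  shows False
proof -
  have n0: "qnorm n \<noteq> 0" using n[of 0] by simp
  obtain g where g: "g \<in> icos" "conj_by g (nconj n ii) \<in> {ii, - ii}"
    using icos_trace0_conj[OF norm[OF icos_gens(1)]] qre_nconj[OF n0] by (metis ijk_simps(16))
  have gn: "qnorm g = 1" using icos_closed(5) g(1) .
  define m where "m = g * n"
  have qm: "qnorm m = qnorm n" by (simp add: m_def gn)
  have m0: "qnorm m \<noteq> 0" using qm n0 by simp
  have mconj: "nconj m h = conj_by g (nconj n h)" for h
    by (simp add: m_def nconj_mult_left nconj_unit[OF gn])
  have mnorm: "nconj m h \<in> icos" if "h \<in> icos" for h
    unfolding mconj using icos_closed(6) g(1) norm that by blast
  have mi: "nconj m ii \<in> {ii, - ii}" using g(2) by (simp add: mconj)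
  define y where "y = nconj m jj"
  have y: "y \<in> icos" "qre y = 0" unfolding y_def using mnorm icos_gens qre_nconj[OF m0] by simp_all
  have "y * nconj m ii = - (nconj m ii * y)"
    unfolding y_def nconj_mult[OF m0, symmetric] by (simp add: nconj_uminus)
  then have "y * ii = - (ii * y)" using mi by (elim insertE emptyE) (simp_all, metis minus_minus)
  note y = icos_anticommute[OF y this]
  have mi: "m * ii = ii * m \<or> m * ii = - (ii * m)"
    using mi nconj_eqD[OF m0] by auto
  show False
  proof (cases "y \<in> {jj, - jj}")
    case True
    then have "m * jj = jj * m \<or> m * jj = - (jj * m)"
      using nconj_eqD[OF m0] unfolding y_def by fastforce
    with mi obtain a q where "m = scalar a * q" "q \<in> {1, ii, jj, kk}" by (rule commute_frame_scalar)
    then have "qnorm m = a * a" by (elim insertE emptyE) simp_all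
    then show ?thesis using n qm by metis
  next
    case False
    then have "m * jj = kk * m \<or> m * jj = - (kk * m)"
      using nconj_eqD[OF m0] y unfolding y_def by fastforce
    with mi obtain a q where m: "m = scalar a * ((1 + ii) * q)" "q \<in> {1, ii, jj, kk}"
      by (rule swap_frame_scalar)
    have a: "a \<noteq> 0" using m0 unfolding m(1) by auto
    have q: "q \<in> icos" using m(2) icos_gens(1-3) icos_closed(1) by blast
    have q: "q \<in> icos" "qnorm q = 1" using q icos_closed(5) by blast+
    \<comment> \<open>As \<open>q\<close> lies in the group, undoing it on \<open>xx\<close> first
      isolates the effect of \<open>1 + ii\<close>.\<close>
    have "nconj m (conj_by (qcnj q) xx) = nconj (scalar a * (1 + ii)) xx"
      unfolding m mult.assoc[symmetric] nconj_mult_left nconj_unit[OF q(2)] conj_by_qcnj[OF q(2)] ..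
    then have "nconj (1 + ii) xx \<in> icos"
      using mnorm[OF icos_closed(6)[OF icos_closed(3)[OF q(1)] icos_gens(5)]]
      by (simp only: nconj_mult_left nconj_scalar[OF a])
    moreover have "nconj (1 + ii) xx = Quat 0 (1/2) (- (f - 1)/2) (f/2)"
      by (rule nconj_eqI) (simp_all add: two qnorm_def ii_def xx_def quat_eq_iff,
          simp add: two field_simps)
    ultimately have w: "Quat 0 (1/2) (- (f - 1)/2) (f/2) * xx \<in> icos" (is "?w \<in> _")
      using icos_closed(2) icos_gens(5) by simp
    have "2 * (2 * qre ?w) = - 1"
    proof -
      have "qre ?w = - (1/4)" by (simp add: xx_def) (simp add: algebra_simps)
      moreover have "2 * (2 * x) = 4 * x" for x :: 'k by simp
      ultimately show ?thesis using four by (simp only: mult_minus_right) simp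
    qed
    then have t: "2 * (2 * qre ?w) + 1 = 0" by simp
    \<comment> \<open>The equation of \<open>f\<close> restated for \<open>2 * f\<close>, the
      quantity that a trace \<plusminus>\<open>f\<close> or \<plusminus>\<open>(f - 1)\<close>
      determines. Each candidate trace makes 1, 3 or 5 vanish.\<close>
    have vv: "(2 * f) * (2 * f) = 2 * (2 * f) + 4" by (simp add: ff)
    have c: "(5::'k) \<noteq> 0" "(3::'k) \<noteq> 0" "(1::'k) \<noteq> 0" using three five by auto
    define r where "r = 2 * qre ?w"
    have t: "2 * r + 1 = 0" using t by (simp only: r_def)
    have t2: "2 * r = - 1" using t by (simp only: eq_neg_iff_add_eq_0)
    have "?w = 1 \<or> ?w = - 1 \<or> r \<in> {0, 1, - 1, f, - f, f - 1, 1 - f}"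
      unfolding r_def by (rule icos_trace[OF w])
    then show ?thesis
    proof (elim disjE insertE emptyE)
      assume "?w = 1" then have "r = 2" unfolding r_def by (simp only: quat_sel mult_1_right)
      then have "(5::'k) = 0" using t by simp
      then show ?thesis using c by simp
    next
      assume "?w = - 1" then have "r = - 2" unfolding r_def by (simp only: quat_sel) simp
      then have "- (3::'k) = 0" using t by simp
      then show ?thesis using c by simp
    next
      assume "r = 0" then show ?thesis using t by simp
    next
      assume "r = 1" then have "(3::'k) = 0" using t by simp
      then show ?thesis using c by simp
    next
      assume "r = - 1" then show ?thesis using t by simp
    next
      assume "r = f" then have v: "2 * f = - 1" using t2 by simp
      then show ?thesis using vv numeral_neq unfolding v by simp
    next
      assume "r = - f" then have v: "2 * f = 1" using t2 by simp
      have "(6::'k) - 1 = 0" using vv unfolding v by simp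
      then show ?thesis using c by simp
    next
      assume "r = f - 1" then have "2 * f = 2 * r + 2" by simp
      then have v: "2 * f = 1" unfolding t2 by simp
      have "(6::'k) - 1 = 0" using vv unfolding v by simp
      then show ?thesis using c by simp
    next
      assume "r = 1 - f" then have "2 * f = 2 - 2 * r" by simp
      then have v: "2 * f = 3" unfolding t2 by simp
      have "(10::'k) - 9 = 0" using vv unfolding v by simp
      then show ?thesis using c by simp
    qed
  qed
qed

end

section \<open>Normalizers of solvable subgroups\<close>

context icosahedral begin

text \<open>The scalar product \<open>D\<close> of parallel vectors of equal norm \<open>N\<close>
  satisfies \<open>D * D = N * N\<close>. Isotropic vectors exist over finite fields, hence the
  condition on \<open>N\<close>.\<close>

lemma parallel_pure:
  fixes u1 :: 'k
  assumes c: "u1 * v2 = u2 * v1" "u1 * v3 = u3 * v1" "u2 * v3 = u3 * v2"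
    and N: "u1 * u1 + u2 * u2 + u3 * u3 = N" "v1 * v1 + v2 * v2 + v3 * v3 = N" "N \<noteq> 0"
  shows "(v1 = u1 \<and> v2 = u2 \<and> v3 = u3) \<or> (v1 = - u1 \<and> v2 = - u2 \<and> v3 = - u3)"
proof -
  define D where "D = u1 * v1 + u2 * v2 + u3 * v3"
  have "D * u1 = u1 * (u1 * v1) + u2 * (u1 * v2) + u3 * (u1 * v3)"
    "D * u2 = u1 * (u2 * v1) + u2 * (u2 * v2) + u3 * (u2 * v3)"
    "D * u3 = u1 * (u3 * v1) + u2 * (u3 * v2) + u3 * (u3 * v3)"
    by (simp_all add: D_def algebra_simps)
  then have "D * u1 = u1 * (u1 * v1) + u2 * (u2 * v1) + u3 * (u3 * v1)"
    "D * u2 = u1 * (u1 * v2) + u2 * (u2 * v2) + u3 * (u3 * v2)"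
    "D * u3 = u1 * (u1 * v3) + u2 * (u2 * v3) + u3 * (u3 * v3)"
    by (simp_all only: c)
  then have e: "N * v1 = D * u1" "N * v2 = D * u2" "N * v3 = D * u3"
    by (simp_all add: N(1)[symmetric] algebra_simps)
  have "N * N = N * v1 * v1 + N * v2 * v2 + N * v3 * v3"
    by (simp add: N(2)[symmetric] algebra_simps)
  also have "\<dots> = D * D" unfolding e by (simp add: D_def algebra_simps)
  finally have "D * D = N * N" ..
  then have "D = N \<or> D = - N" by (simp only: square_eq_iff)
  then show ?thesis
  proof
    assume "D = N"
    then show ?thesis using e N(3) by (simp only: mult_cancel_left) blast
  next
    assume "D = - N"
    then have "N * v1 = N * (- u1)" "N * v2 = N * (- u2)" "N * v3 = N * (- u3)" using e by simp_all
    then show ?thesis using N(3) by (simp only: mult_cancel_left) blast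
  qed
qed

text \<open>Commuting quaternions have parallel pure parts, here of equal norm; the condition on the
  trace says that this norm is nonzero.\<close>

lemma commute_same_trace:
  fixes a b :: "'k quat"
  assumes n: "qnorm a = 1" "qnorm b = 1" and re: "qre b = qre a" and c: "a * b = b * a"
    and t: "4 \<noteq> (2 * qre a) * (2 * qre a)"
  shows "b = a \<or> b = qcnj a"
proof -
  have eq: "qj a * qk b - qk a * qj b + (qj a * qk b - qk a * qj b) = 0 + 0"
    "qk a * qi b - qi a * qk b + (qk a * qi b - qi a * qk b) = 0 + 0"
    "qi a * qj b - qj a * qi b + (qi a * qj b - qj a * qi b) = 0 + 0"
    using c by (simp_all add: quat_eq_iff algebra_simps)
  let ?N = "1 - qre a * qre a"
  have "4 * ?N \<noteq> 0" using t by (simp add: algebra_simps)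
  then have N: "?N \<noteq> 0" by auto
  have "(qi b = qi a \<and> qj b = qj a \<and> qk b = qk a) \<or> (qi b = - qi a \<and> qj b = - qj a \<and> qk b = - qk a)"
    using eq n re unfolding add_self_eq_iff qnorm_def
    by (intro parallel_pure[OF _ _ _ _ _ N]) (auto simp: algebra_simps)
  then show ?thesis using re by (auto simp: quat_eq_iff)
qed

lemma nonsquare_norm_trace:
  assumes "a \<in> icos" "a \<noteq> 1" "a \<noteq> - 1"
  obtains e where "e = 1 \<or> e = - 1" "\<And>s. qnorm (1 + scalar e * a) \<noteq> s * s" "4 \<noteq> (2 * qre a) * (2 * qre a)"
proof -
  have n: "qnorm a = 1" using icos_closed(5) assms(1) .
  have nt: "qnorm (1 + scalar e * a) = 2 + e * (2 * qre a)" if "e = 1 \<or> e = - 1" for e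
  proof -
    have "qnorm (1 + scalar e * a) = 1 + e * (2 * qre a) + e * e * qnorm a"
      by (simp add: qnorm_def algebra_simps)
    then show ?thesis using that n by auto
  qed
  have "2 * qre a \<in> {0, 1, - 1, f, - f, f - 1, 1 - f}" using icos_trace assms by blast
  then obtain e where e: "e = 1 \<or> e = - 1" "2 + e * (2 * qre a) \<in> {2, 3, f + 2, 3 - f}"
  proof (elim insertE emptyE)
    assume "2 * qre a = 0" then show thesis using that[of 1] by simp
  next
    assume "2 * qre a = 1" then show thesis using that[of 1] by simp
  next
    assume "2 * qre a = - 1" then show thesis using that[of "- 1"] by simp
  next
    assume "2 * qre a = f" then show thesis using that[of 1] by (simp add: add.commute)
  next
    assume "2 * qre a = - f" then show thesis using that[of "- 1"] by (simp add: add.commute)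
  next
    assume "2 * qre a = f - 1" then show thesis using that[of "- 1"] by (simp add: algebra_simps)
  next
    assume "2 * qre a = 1 - f" then show thesis using that[of 1] by (simp add: algebra_simps)
  qed
  have ns: "qnorm (1 + scalar e * a) \<noteq> s * s" for s
  proof
    assume "qnorm (1 + scalar e * a) = s * s"
    then have "s * s \<in> {2, 3, f + 2, 3 - f}" using e(2) nt[OF e(1)] by simp
    then show False using nonsq by blast
  qed
  have "4 \<noteq> (2 * qre a) * (2 * qre a)"
  proof
    \<comment> \<open>A trace \<plusminus>2 would give norm 0 or 4, both squares.\<close>
    assume "4 = (2 * qre a) * (2 * qre a)"
    then have "(2 * qre a) * (2 * qre a) = 2 * 2" by simp
    then have "2 * qre a = 2 \<or> 2 * qre a = - 2" by (simp only: square_eq_iff)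
    then obtain t where "t = 2 \<or> t = - 2" "qnorm (1 + scalar e * a) = 2 + e * t"
      using nt[OF e(1)] by metis
    then have "qnorm (1 + scalar e * a) \<in> {0 * 0, 2 * 2}" using e(1) by auto
    then show False using ns by blast
  qed
  then show thesis using that e(1) ns by blast
qed

definition good_normalizer :: "'k quat set \<Rightarrow> 'k quat \<Rightarrow> bool" where
  "good_normalizer K n \<longleftrightarrow> (\<forall>s. qnorm n \<noteq> s * s) \<and> (\<forall>k\<in>K. nconj n k \<in> K)"

text \<open>
  An element \<open>k\<close> of \<open>K\<close> either commutes with \<open>a\<close> or inverts it; in the latter case
  \<open>k * k = - 1\<close>, and conjugation by \<open>1 + e * a\<close> sends \<open>k\<close> to \<open>e * (k * inverse a)\<close>.
\<close>

lemma abelian_case: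
  assumes K: "K \<subseteq> icos" "1 \<in> K" "\<And>x y. x \<in> K \<Longrightarrow> y \<in> K \<Longrightarrow> x * y \<in> K" "\<And>x. x \<in> K \<Longrightarrow> qcnj x \<in> K"
    and L: "L \<subseteq> K" "\<And>k x. k \<in> K \<Longrightarrow> x \<in> L \<Longrightarrow> conj_by k x \<in> L"
    and a: "a \<in> L" "a \<noteq> 1" "a \<noteq> - 1" and comm: "\<And>x y. x \<in> L \<Longrightarrow> y \<in> L \<Longrightarrow> x * y = y * x"
  shows "\<exists>n. good_normalizer K n"
proof -
  have aI: "a \<in> icos" using a K L by auto
  have na: "qnorm a = 1" using icos_closed(5) aI .
  obtain e where e: "e = 1 \<or> e = - 1" and ns: "\<And>s. qnorm (1 + scalar e * a) \<noteq> s * s"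
    and t: "4 \<noteq> (2 * qre a) * (2 * qre a)" using nonsquare_norm_trace[OF aI a(2,3)] by blast
  define n where "n = 1 + scalar e * a"
  have n0: "qnorm n \<noteq> 0" using ns[of 0] by (simp add: n_def)
  have ee: "scalar e = 1 \<or> scalar e = - 1" using e by (auto simp: scalar_hom)
  have "nconj n k \<in> K" if k: "k \<in> K" for k
  proof -
    have nk: "qnorm k = 1" using icos_closed(5)[OF subsetD[OF K(1) k]] .
    have b: "conj_by k a \<in> L" using L(2) k a(1) .
    have "conj_by k a = a \<or> conj_by k a = qcnj a"
      by (rule commute_same_trace)
        (use na nk t b a comm in \<open>simp_all add: qnorm_conj_by qre_conj_by\<close>)
    then show ?thesis
    proof
      assume "conj_by k a = a"
      then have "k * a = a * k" using conj_by_eqD[OF nk] by blast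
      then have "n * k = k * n" using ee by (auto simp: n_def algebra_simps)
      then show ?thesis using nconj_eqI[OF n0] k by simp
    next
      assume inv: "conj_by k a = qcnj a"
      then have ka: "k * a = qcnj a * k" using conj_by_eqD[OF nk] by blast
      have "conj_by k (qcnj a) = qcnj (conj_by k a)" by (simp add: conj_by_def mult.assoc)
      then have "conj_by k (qcnj a) = a" using inv by simp
      then have ak: "k * qcnj a = a * k" using conj_by_eqD[OF nk] by blast
      have kk: "k * k = - 1"
      proof -
        \<comment> \<open>\<open>k\<close> anticommutes with \<open>a - qcnj a\<close>, so it is
          conjugate to \<open>- k\<close> and has trace zero.\<close>
        let ?w = "a - qcnj a"
        have kw: "k * ?w = - (?w * k)" by (simp add: algebra_simps ka ak)
        have nw: "qnorm ?w = 4 - (2 * qre a) * (2 * qre a)"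
        proof -
          have "qnorm ?w = 4 * qnorm a - (2 * qre a) * (2 * qre a)"
            by (simp add: qnorm_def algebra_simps)
          then show ?thesis using na by simp
        qed
        have w0: "qnorm ?w \<noteq> 0" using t unfolding nw by simp
        have "nconj ?w k = - k" using kw by (intro nconj_eqI[OF w0]) simp
        then have "qre k = qre (- k)" using qre_nconj[OF w0] by metis
        then have "qre k = 0" by simp
        then show ?thesis using quat_square[of k] nk by simp
      qed
      have m1: "- 1 \<in> K" using K(3)[OF k k] kk by simp
      have "scalar e * (k * qcnj a) \<in> K"
        using ee K(3)[OF k K(4)] K(3)[OF m1 K(3)[OF k K(4)]] a(1) L(1) by auto
      moreover have "nconj n k = scalar e * (k * qcnj a)"
      proof (rule nconj_eqI[OF n0])
        have "qcnj a * a = 1" using unit_qcnj[OF na] by simp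
        then show "n * k = scalar e * (k * qcnj a) * n"
          using ee by (auto simp: n_def algebra_simps simp flip: ak)
      qed
      ultimately show ?thesis by simp
    qed
  qed
  then show ?thesis using ns unfolding good_normalizer_def n_def by blast
qed

lemma nconj_one_ii:
  "nconj (1 + ii) (Quat a b c d) = Quat a b (- d) c"
  by (rule nconj_eqI) (simp_all add: two qnorm_def ii_def quat_eq_iff)

lemma commute_up_to_sign_uminus:
  fixes x v :: "'k quat"
  shows "x * (- v) = (- v) * x \<or> x * (- v) = - ((- v) * x) \<Longrightarrow> x * v = v * x \<or> x * v = - (v * x)"
  unfolding mult_minus_left mult_minus_right minus_minus neg_equal_iff_equal
  by (elim disjE) (simp_all add: eq_neg_iff_add_eq_0 neg_eq_iff_add_eq_0)

text \<open>Conjugation by \<open>1 + ii\<close> takes a Hurwitz unit \<open>k\<close> to a conjugate of its inverse.\<close>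

lemma quaternion_case:
  assumes K: "K \<subseteq> icos" "1 \<in> K" "\<And>x y. x \<in> K \<Longrightarrow> y \<in> K \<Longrightarrow> x * y \<in> K" "\<And>x. x \<in> K \<Longrightarrow> qcnj x \<in> K"
    and L: "L \<subseteq> K" "\<And>k x. k \<in> K \<Longrightarrow> x \<in> L \<Longrightarrow> conj_by k x \<in> L"
    and ij: "v \<in> L" "w \<in> L" "v \<in> {ii, - ii}" "w \<in> {jj, - jj, kk, - kk}"
    and comm: "\<And>x y. x \<in> L \<Longrightarrow> y \<in> L \<Longrightarrow> x * y = y * x \<or> x * y = - (y * x)"
  shows "good_normalizer K (1 + ii)"
proof -
  have vw: "v \<in> K" "w \<in> K" using ij L by auto
  have "v * v = - 1" using ij by auto
  then have m1: "- 1 \<in> K" using K(3)[OF vw(1) vw(1)] by simp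
  have neg: "- x \<in> K" if "x \<in> K" for x using K(3)[OF m1 that] by simp
  have iK: "ii \<in> K" using vw(1) neg[OF vw(1)] ij(3) by auto
  have "jj \<in> K \<or> kk \<in> K" using vw(2) neg[OF vw(2)] ij(4) by auto
  then have jkK: "jj \<in> K" "kk \<in> K"
    using K(3)[OF iK, of jj] K(3)[OF _ iK, of kk] by auto
  have axK: "axes \<subseteq> K" unfolding axes_def insert_subset by (intro conjI iK jkK neg empty_subsetI)
  \<comment> \<open>Commuting up to sign with \<open>v\<close> and \<open>w\<close> confines
    \<open>L\<close> to the quaternion group, so every \<open>k\<close> permutes the axes and is a
    Hurwitz unit.\<close>
  have L_axes: "x \<in> {1, - 1} \<union> axes" if x: "x \<in> L" for x
  proof -
    have n: "qnorm x = 1" using icos_closed(5)[OF subsetD[OF K(1) subsetD[OF L(1) x]]] .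
    have i: "x * ii = ii * x \<or> x * ii = - (ii * x)" using comm[OF x ij(1)] ij(3) commute_up_to_sign_uminus[of x ii] by blast
    have "x * jj = jj * x \<or> x * jj = - (jj * x) \<or> x * kk = kk * x \<or> x * kk = - (kk * x)"
      using comm[OF x ij(2)] ij(4) commute_up_to_sign_uminus[of x jj] commute_up_to_sign_uminus[of x kk]
      by blast
    moreover have "x * jj = jj * x \<or> x * jj = - (jj * x)" if k: "x * kk = kk * x \<or> x * kk = - (kk * x)"
    proof -
      have e: "x * jj = (x * kk) * ii" by (simp add: mult.assoc)
      have k': "(x * kk) * ii = kk * (x * ii) \<or> (x * kk) * ii = - (kk * (x * ii))"
        using k by (elim disjE) (simp_all only: mult.assoc mult_minus_left simp_thms)
      have i': "kk * (x * ii) = kk * (ii * x) \<or> kk * (x * ii) = - (kk * (ii * x))"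
        using i by (elim disjE) (simp_all only: mult_minus_right simp_thms)
      have "kk * (ii * x) = jj * x" by (simp flip: mult.assoc)
      then show ?thesis unfolding e using k' i' by (elim disjE) simp_all
    qed
    ultimately obtain a q where "x = scalar a * q" "q \<in> {1, ii, jj, kk}"
      using commute_frame_scalar[OF i] by metis
    from norm_one_scalar[OF this n] show ?thesis by (auto simp: axes_def)
  qed
  have "nconj (1 + ii) k \<in> K" if k: "k \<in> K" for k
  proof -
    have n: "qnorm k = 1" using icos_closed(5)[OF subsetD[OF K(1) k]] .
    have axc: "conj_by k x \<in> axes" if "x \<in> L" "x \<in> axes" for x
    proof -
      have "qre (conj_by k x) = 0" using qre_conj_by[OF n] axes_re[OF that(2)] by simp
      then show ?thesis using L_axes[OF L(2)[OF k that(1)]] by auto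
    qed
    have neg_axes: "- x \<in> axes \<longleftrightarrow> x \<in> axes" for x unfolding axes_def by (auto simp: minus_equation_iff)
    have va: "v \<in> axes" "w \<in> axes" using ij(3,4) unfolding axes_def by blast+
    have ci: "conj_by k ii \<in> axes"
      using axc[OF ij(1) va(1)] ij(3) by (elim insertE emptyE) (simp_all add: conj_by_uminus neg_axes)
    have cw: "conj_by k w \<in> axes" using axc[OF ij(2) va(2)] .
    have "conj_by k jj \<in> axes"
    proof (cases "w \<in> {jj, - jj}")
      case True then show ?thesis
        using cw by (elim insertE emptyE) (simp_all add: conj_by_uminus neg_axes)
    next
      case False
      then have "conj_by k kk \<in> axes" 
        using cw ij(4) by (elim insertE emptyE) (simp_all add: conj_by_uminus neg_axes)
      moreover have "conj_by k jj = conj_by k kk * conj_by k ii"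
        by (simp flip: conj_by_prod[OF n])
      ultimately have "conj_by k jj \<in> axes \<union> {1, - 1}" using ci unfolding axes_def
        by (elim insertE emptyE) simp_all
      moreover have "qre (conj_by k jj) = 0" using qre_conj_by[OF n] by simp
      ultimately show ?thesis by auto
    qed
    from axes_stab[OF n ci this] consider "k \<in> {1, - 1}" | "k \<in> axes" | "k \<in> hurwitz" by blast
    then show ?thesis
    proof cases
      case 1
      have "nconj (1 + ii) 1 = 1" by (rule nconj_eqI) (simp_all add: qnorm_def ii_def two)
      then show ?thesis using 1 K(2) m1 by (elim insertE emptyE) (simp_all add: nconj_uminus)
    next
      case 2
      have "nconj (1 + ii) ii = ii" "nconj (1 + ii) jj = kk" "nconj (1 + ii) kk = - jj"
        by (rule nconj_eqI; simp add: qnorm_def ii_def jj_def kk_def quat_eq_iff two)+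
      then have "nconj (1 + ii) k \<in> axes" using 2 unfolding axes_def by (elim insertE emptyE) (simp_all add: nconj_uminus)
      then show ?thesis using axK by blast
    next
      case 3
      then obtain a b c d where q: "k = Quat a b c d" and cd: "{a, b, c, d} \<subseteq> {1/2, - 1/2}"
        unfolding hurwitz_def by blast
      have "c = 1/2 \<or> c = - 1/2" "d = 1/2 \<or> d = - 1/2" using cd by blast+
      then have cd: "c = d \<or> c = - d"
        by (metis minus_divide_left minus_minus)
      have "conj_by jj (qcnj k) \<in> K" "conj_by kk (qcnj k) \<in> K"
        unfolding conj_by_def by (intro K(3,4) k jkK)+
      \<comment> \<open>Equal signs of \<open>c\<close> and \<open>d\<close> select
        \<open>jj\<close>, opposite signs \<open>kk\<close>.\<close>
      moreover have "nconj (1 + ii) k = conj_by jj (qcnj k) \<or> nconj (1 + ii) k = conj_by kk (qcnj k)"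
        using cd unfolding q nconj_one_ii
        by (auto simp: conj_by_def jj_def kk_def qcnj_def times_quat_def)
      ultimately show ?thesis by metis
    qed
  qed
  moreover have "qnorm (1 + ii) \<noteq> s * s" for s
    using nonsq(1)[of s] by (auto simp: qnorm_def ii_def)
  ultimately show ?thesis unfolding good_normalizer_def by blast
qed

text \<open>Two anticommuting elements of \<open>L\<close> have trace zero, so some \<open>g\<close>
  in the group moves them to the axes. There \<open>1 + ii\<close> normalizes, and conjugating it
  back by \<open>g\<close> keeps its norm.\<close>

lemma icos_solvable_normalizer:
  assumes K: "K \<subseteq> icos" "1 \<in> K" "\<And>x y. x \<in> K \<Longrightarrow> y \<in> K \<Longrightarrow> x * y \<in> K" "\<And>x. x \<in> K \<Longrightarrow> qcnj x \<in> K"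
    and L: "L \<subseteq> K" "\<And>k x. k \<in> K \<Longrightarrow> x \<in> L \<Longrightarrow> conj_by k x \<in> L"
    and a: "a \<in> L" "a \<noteq> 1" "a \<noteq> - 1"
    and comm: "\<And>x y. x \<in> L \<Longrightarrow> y \<in> L \<Longrightarrow> x * y = y * x \<or> x * y = - (y * x)"
  shows "\<exists>n. good_normalizer K n"
proof (cases "\<forall>x\<in>L. \<forall>y\<in>L. x * y = y * x")
  case True
  then show ?thesis using abelian_case[OF K L a] by blast
next
  case False
  then obtain x y where xy: "x \<in> L" "y \<in> L" "x * y = - (y * x)" using comm by blast
  have I: "x \<in> icos" "y \<in> icos" using xy L K by auto
  have n: "qnorm x = 1" "qnorm y = 1" using I icos_closed(5) by auto
  have re0: "qre x = 0" if "x * y = - (y * x)" "qnorm y = 1" for x y :: "'k quat"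
  proof -
    have "y * x = - (x * y)" using that(1) by simp
    then have "conj_by y x = - (x * (y * qcnj y))" by (simp only: conj_by_def mult_minus_left mult.assoc)
    then have "conj_by y x = - x" using unit_qcnj(1)[OF that(2)] by simp
    then have "qre x = qre (- x)" using qre_conj_by[OF that(2)] by metis
    then show ?thesis by simp
  qed
  have re: "qre x = 0" "qre y = 0" using re0[OF xy(3) n(2)] re0[of y x] xy(3) n(1) by simp_all
  obtain g where g: "g \<in> icos" "conj_by g x \<in> {ii, - ii}" using icos_trace0_conj[OF I(1) re(1)] .
  have gn: "qnorm g = 1" using icos_closed(5) g(1) .
  have cg: "conj_by (conj_by g k) (conj_by g z) = conj_by g (conj_by k z)" for k z
    using gn by (simp add: conj_by_def mult.assoc unit_qcnj)
  have "conj_by g y * conj_by g x = - (conj_by g x * conj_by g y)"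
    using xy(3) by (simp add: conj_by_uminus flip: conj_by_prod[OF gn])
  then have anti: "conj_by g y * ii = - (ii * conj_by g y)"
    using g(2) by (elim insertE emptyE) (simp_all, metis minus_minus)
  have y: "conj_by g y \<in> {jj, - jj, kk, - kk}"
    by (rule icos_anticommute[OF _ _ anti]) (use icos_closed(6) g(1) I re qre_conj_by[OF gn] in simp_all)
  have "good_normalizer (conj_by g ` K) (1 + ii)"
  proof (rule quaternion_case[where L = "conj_by g ` L" and v = "conj_by g x" and w = "conj_by g y"])
    show "conj_by g ` K \<subseteq> icos" using icos_closed(6) g(1) K(1) by blast
    show "1 \<in> conj_by g ` K" using K(2) unit_qcnj(1)[OF gn] by (force simp: conj_by_def image_iff)
    show "u * v \<in> conj_by g ` K" if "u \<in> conj_by g ` K" "v \<in> conj_by g ` K" for u v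
      using that K(3) by (auto simp flip: conj_by_prod[OF gn])
    show "qcnj u \<in> conj_by g ` K" if u: "u \<in> conj_by g ` K" for u
    proof -
      obtain z where z: "z \<in> K" "u = conj_by g z" using u by blast
      have "qcnj u = conj_by g (qcnj z)" by (simp add: z conj_by_def mult.assoc)
      then show ?thesis using K(4) z(1) by blast
    qed
    show "conj_by g ` L \<subseteq> conj_by g ` K" using L(1) by blast
    show "conj_by k u \<in> conj_by g ` L" if "k \<in> conj_by g ` K" "u \<in> conj_by g ` L" for k u
      using that L(2) cg by fastforce
    show "u * v = v * u \<or> u * v = - (v * u)" if "u \<in> conj_by g ` L" "v \<in> conj_by g ` L" for u v
      using that comm by (auto simp flip: conj_by_prod[OF gn] conj_by_uminus) metis+
  qed (use xy g(2) y in auto)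
  then have gn1: "\<And>s. qnorm (1 + ii) \<noteq> s * s"
    and gK: "\<And>k. k \<in> K \<Longrightarrow> nconj (1 + ii) (conj_by g k) \<in> conj_by g ` K"
    unfolding good_normalizer_def by blast+
  have "nconj (qcnj g * (1 + ii) * g) k \<in> K" if k: "k \<in> K" for k
  proof -
    obtain z where z: "z \<in> K" "nconj (1 + ii) (conj_by g k) = conj_by g z" using gK[OF k] by blast
    have "qnorm (qcnj g) = 1" using gn by simp
    then have "nconj (qcnj g * (1 + ii) * g) k = conj_by (qcnj g) (conj_by g z)"
      by (simp add: nconj_mult_left nconj_unit gn z(2))
    then show ?thesis using z(1) conj_by_qcnj[OF gn] by simp
  qed
  moreover have "qnorm (qcnj g * (1 + ii) * g) = qnorm (1 + ii)" using gn by simp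
  ultimately show ?thesis using gn1 unfolding good_normalizer_def by metis
qed

end

section \<open>Transfer to matrices\<close>

text \<open>\<open>rel\<close> makes the matrix representing \<open>jj\<close> square to
  \<open_minus>1, which splits the quaternion algebra.\<close>

locale icosahedral_matrices = icosahedral f for f :: "'k::{field,finite}" +
  fixes al be :: 'k
  assumes rel: "be * be = - 1 - al * al"
    and nonsquares_mult: "\<And>a b :: 'k. (\<And>s. a \<noteq> s * s) \<Longrightarrow> (\<And>s. b \<noteq> s * s) \<Longrightarrow> \<exists>s. a * b = s * s"
begin

text \<open>
  The isomorphism from the quaternions to the matrix algebra that sends \<open>i\<close> to
  \<open>((0, -1), (1, 0))\<close> and \<open>j\<close> to \<open>((al, be), (be, -al))\<close>.
\<close>

definition E :: "'k quat \<Rightarrow> 'k ^ 2 ^ 2" where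
  "E q = vector [vector [qre q + al * qj q - be * qk q, - qi q + be * qj q + al * qk q],
                 vector [qi q + be * qj q + al * qk q, qre q - al * qj q + be * qk q]]"

lemma rel': "be * (be * x) = - x - al * (al * x)"
proof -
  have "be * (be * x) = (be * be) * x" by simp
  then show ?thesis unfolding rel by (simp add: algebra_simps)
qed

lemma E_mult: "E (x * y) = E x ** E y"
  by (simp add: E_def vec_eq_iff forall_2 matrix_matrix_mult_def sum_2 algebra_simps rel rel')

lemma E_one: "E 1 = mat 1"
  by (simp add: E_def vec_eq_iff forall_2 mat_def)

lemma E_uminus: "E (- x) = - E x"
  by (simp add: E_def vec_eq_iff forall_2)

lemma det_E: "det (E x) = qnorm x"
  by (simp add: det_2 E_def qnorm_def algebra_simps rel rel')

lemma E_inj: "E x = E y \<longleftrightarrow> x = y"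
proof
  assume eq: "E x = E y"
  define q where "q = x - y"
  have c: "qre q + al * qj q - be * qk q = 0" "- qi q + be * qj q + al * qk q = 0"
    "qi q + be * qj q + al * qk q = 0" "qre q - al * qj q + be * qk q = 0"
    using eq by (simp_all add: q_def E_def vec_eq_iff forall_2 algebra_simps)
  define U V where "U = al * qj q - be * qk q" and "V = be * qj q + al * qk q"
  have c: "qre q + U = 0" "- qi q + V = 0" "qi q + V = 0" "qre q - U = 0"
    using c by (simp_all add: U_def V_def algebra_simps)
  have "qre q + qre q = (qre q + U) + (qre q - U)" "U + U = (qre q + U) - (qre q - U)"
    "qi q + qi q = (qi q + V) - (- qi q + V)" "V + V = (qi q + V) + (- qi q + V)" by simp_all
  then have "qre q + qre q = 0 + 0" "U + U = 0 + 0" "qi q + qi q = 0 + 0" "V + V = 0 + 0"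
    unfolding c by simp_all
  then have z: "qre q = 0" "qi q = 0" "al * qj q - be * qk q = 0" "be * qj q + al * qk q = 0"
    by (simp_all only: add_self_eq_iff U_def V_def)
  \<comment> \<open>The linear map taking \<open>(qj q, qk q)\<close> to \<open>(U, V)\<close> has
    determinant \<open>al * al + be * be = - 1\<close>; these combinations invert it.\<close>
  have "- qj q = al * (al * qj q - be * qk q) + be * (be * qj q + al * qk q)"
    by (simp add: algebra_simps rel rel')
  moreover have "- qk q = al * (be * qj q + al * qk q) - be * (al * qj q - be * qk q)"
    by (simp add: algebra_simps rel rel')
  ultimately have "qj q = 0" "qk q = 0" unfolding z by simp_all
  with z have "q = 0" by (simp add: quat_eq_iff)
  then show "x = y" by (simp add: q_def)
qed simp

lemma E_surj: "\<exists>q. M = E q"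
proof -
  let ?m = "\<lambda>i j. vec_nth (vec_nth M i) j"
  define a b u v where "a = (?m 1 1 + ?m 2 2) / 2" and "b = (?m 2 1 - ?m 1 2) / 2"
    and "u = (?m 1 1 - ?m 2 2) / 2" and "v = (?m 2 1 + ?m 1 2) / 2"
  have h: "(x + y) / 2 + (x - y) / 2 = x" "(x + y) / 2 - (x - y) / 2 = y" for x y :: 'k
  proof -
    have "(x + y) / 2 + (x - y) / 2 = (2 * x) / 2" "(x + y) / 2 - (x - y) / 2 = (2 * y) / 2"
      by (simp_all flip: add_divide_distrib diff_divide_distrib)
    then show "(x + y) / 2 + (x - y) / 2 = x" "(x + y) / 2 - (x - y) / 2 = y"
      using two by simp_all
  qed
  have c: "a + u = ?m 1 1" "v - b = ?m 1 2" "v + b = ?m 2 1" "a - u = ?m 2 2"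
    unfolding a_def b_def u_def v_def by (rule h)+
  have "E (Quat a b (- (al * u + be * v)) (- (al * v - be * u))) =
      vector [vector [a + u, v - b], vector [v + b, a - u]]"
    by (simp add: E_def vec_eq_iff forall_2 algebra_simps rel rel')
  also have "\<dots> = M" unfolding c by (simp add: vec_eq_iff forall_2)
  finally show ?thesis by metis
qed

lemma carrier_SL2: "carrier SL2 = E ` {q. qnorm q = 1}"
proof (intro equalityI subsetI)
  fix M :: "'k ^ 2 ^ 2" assume M: "M \<in> carrier SL2"
  obtain q where q: "M = E q" using E_surj by blast
  then have "qnorm q = 1" using M det_E[of q] by (simp add: SL2_def)
  then show "M \<in> E ` {q. qnorm q = 1}" using q by blast
qed (auto simp: SL2_def det_E)

lemma SL2_mult: "E x \<otimes>\<^bsub>SL2\<^esub> E y = E (x * y)"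
  by (simp add: SL2_def E_mult)

lemma SL2_one: "\<one>\<^bsub>SL2\<^esub> = E 1"
  by (simp add: SL2_def E_one)

lemma SL2_inv: "qnorm q = 1 \<Longrightarrow> inv\<^bsub>SL2\<^esub> (E q) = E (qcnj q)"
  by (rule group.inv_equality[OF group_SL2]) (auto simp: SL2_mult SL2_one unit_qcnj carrier_SL2)

lemma SL2_conj: "qnorm q = 1 \<Longrightarrow> E q \<otimes>\<^bsub>SL2\<^esub> E x \<otimes>\<^bsub>SL2\<^esub> inv\<^bsub>SL2\<^esub> (E q) = E (nconj q x)"
  by (simp add: SL2_inv SL2_mult nconj_unit conj_by_def)

lemma proj_E: "proj (E x) = {E x, E (- x)}"
  by (simp add: proj_eq E_uminus)

lemma proj_E_eq: "proj (E x) = proj (E y) \<longleftrightarrow> x = y \<or> x = - y"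
  unfolding proj_E by (auto simp: doubleton_eq_iff E_inj)

definition "H1 = E ` icos"

lemma subgroup_H1: "subgroup H1 SL2"
proof (rule group.subgroupI[OF group_SL2])
  show "H1 \<subseteq> carrier SL2" using icos_closed(5) by (auto simp: H1_def carrier_SL2)
  show "H1 \<noteq> {}" using icos_closed(1) by (auto simp: H1_def)
  show "inv\<^bsub>SL2\<^esub> a \<in> H1" if "a \<in> H1" for a
    using that icos_closed(3,5) by (auto simp: H1_def SL2_inv)
  show "a \<otimes>\<^bsub>SL2\<^esub> b \<in> H1" if "a \<in> H1" "b \<in> H1" for a b
    using that icos_closed(2) by (auto simp: H1_def SL2_mult)
qed

section \<open>Twisting by an element of nonsquare norm\<close>

abbreviation "gg \<equiv> 1 + ii :: 'k quat"

lemma norm_gg: "qnorm gg = 2"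
  by (simp add: qnorm_def ii_def)

lemma gg0: "qnorm gg \<noteq> 0" by (simp only: norm_gg two not_False_eq_True)

definition twist :: "'k ^ 2 ^ 2 \<Rightarrow> 'k ^ 2 ^ 2" where "twist M = E gg ** M ** E (qinv gg)"

lemma twist_E: "twist (E x) = E (nconj gg x)"
  by (simp only: twist_def nconj_def E_mult)

lemma nconj_nconj_qinv:
  fixes n :: "'k quat"
  assumes "qnorm n \<noteq> 0"
  shows "nconj n (nconj (qinv n) x) = x" "nconj (qinv n) (nconj n x) = x"
proof -
  have "nconj 1 x = x" by (simp add: nconj_unit)
  then show "nconj n (nconj (qinv n) x) = x" "nconj (qinv n) (nconj n x) = x"
    using qinv(1,2)[OF assms] by (simp_all flip: nconj_mult_left)
qed

lemma qnorm_nconj: "qnorm n \<noteq> 0 \<Longrightarrow> qnorm (nconj n x) = qnorm x"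
proof -
  assume n: "qnorm n \<noteq> 0"
  have "qnorm n * qnorm (qinv n) = 1" using arg_cong[OF qinv(1)[OF n], of qnorm] by simp
  then show ?thesis by (simp add: nconj_def)
qed

lemma twist_iso: "twist \<in> iso SL2 SL2"
proof -
  have "twist \<in> hom SL2 SL2"
    by (rule homI) (auto simp: carrier_SL2 twist_E SL2_mult qnorm_nconj[OF gg0] nconj_mult[OF gg0])
  moreover have "bij_betw twist (carrier SL2) (carrier SL2)"
    unfolding carrier_SL2
  proof (rule bij_betwI')
    show "twist x = twist y \<longleftrightarrow> x = y" if "x \<in> E ` {q. qnorm q = 1}" "y \<in> E ` {q. qnorm q = 1}" for x y
      using that by (auto simp: twist_E E_inj) (metis nconj_nconj_qinv(2)[OF gg0])
    show "twist x \<in> E ` {q. qnorm q = 1}" if "x \<in> E ` {q. qnorm q = 1}" for x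
      using that by (auto simp: twist_E qnorm_nconj[OF gg0])
    show "\<exists>x\<in>E ` {q. qnorm q = 1}. y = twist x" if y: "y \<in> E ` {q. qnorm q = 1}" for y
    proof -
      obtain q where q: "qnorm q = 1" "y = E q" using y by blast
      have "qnorm (nconj (qinv gg) q) = 1"
        using qnorm_nconj[OF gg0, of "nconj (qinv gg) q"] q(1) by (simp only: nconj_nconj_qinv(1)[OF gg0])
      moreover have "y = twist (E (nconj (qinv gg) q))"
        unfolding twist_E q(2) nconj_nconj_qinv(1)[OF gg0] ..
      ultimately show ?thesis by blast
    qed
  qed
  ultimately show ?thesis by (simp add: iso_def)
qed

lemma twist_uminus: "twist (- M) = - twist M"
proof -
  obtain q where "M = E q" using E_surj by blast
  then show ?thesis by (simp add: twist_E nconj_uminus flip: E_uminus)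
qed

lemma twist_proj: "twist ` proj M = proj (twist M)"
  by (simp add: proj_eq twist_uminus)

lemma ptwist_iso: "(`) twist \<in> iso PSL2 PSL2"
proof -
  have tc: "twist A \<in> carrier SL2" if "A \<in> carrier SL2" for A
    using twist_iso that by (auto simp: iso_def hom_def)
  have tm: "twist (A \<otimes>\<^bsub>SL2\<^esub> B) = twist A \<otimes>\<^bsub>SL2\<^esub> twist B" if "A \<in> carrier SL2" "B \<in> carrier SL2" for A B
    using twist_iso that by (auto simp: iso_def hom_def)
  have pm: "proj A \<otimes>\<^bsub>PSL2\<^esub> proj B = proj (A \<otimes>\<^bsub>SL2\<^esub> B)" if "A \<in> carrier SL2" "B \<in> carrier SL2" for A B :: "'k^2^2"
    using hom_mult[OF proj_hom that] by simp
  have "(`) twist \<in> hom PSL2 PSL2"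
  proof (rule homI)
    fix U V :: "('k ^ 2 ^ 2) set" assume "U \<in> carrier PSL2" "V \<in> carrier PSL2"
    then obtain A B where AB: "A \<in> carrier SL2" "B \<in> carrier SL2" "U = proj A" "V = proj B"
      unfolding carrier_PSL2 by blast
    show "twist ` U \<in> carrier PSL2" unfolding AB twist_proj carrier_PSL2 using tc AB(1) by blast
    show "twist ` (U \<otimes>\<^bsub>PSL2\<^esub> V) = twist ` U \<otimes>\<^bsub>PSL2\<^esub> twist ` V"
      unfolding AB(3,4) pm[OF AB(1,2)] twist_proj pm[OF tc[OF AB(1)] tc[OF AB(2)]] tm[OF AB(1,2)] ..
  qed
  moreover have "bij_betw ((`) twist) (carrier PSL2) (carrier PSL2)"
  proof -
    have t: "twist ` carrier SL2 = carrier SL2" using twist_iso by (auto simp: iso_def bij_betw_def)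
    have "inj twist"
    proof (rule injI)
      fix x y assume "twist x = twist y"
      moreover obtain p q where "x = E p" "y = E q" using E_surj by metis
      ultimately show "x = y" by (simp add: twist_E E_inj) (metis nconj_nconj_qinv(2)[OF gg0])
    qed
    then have "inj_on ((`) twist) (carrier PSL2)" by (auto intro!: inj_onI simp: inj_image_eq_iff)
    moreover have "(`) twist ` carrier PSL2 = carrier PSL2"
    proof -
      have "(`) twist ` carrier PSL2 = proj ` twist ` carrier SL2"
        unfolding carrier_PSL2 image_image twist_proj ..
      then show ?thesis unfolding t carrier_PSL2 .
    qed
    ultimately show ?thesis by (simp add: bij_betw_def)
  qed
  ultimately show ?thesis by (simp add: iso_def)
qed

definition "H2 = twist ` H1"

lemma H2_eq: "H2 = E ` nconj gg ` icos"
  by (simp add: H2_def H1_def image_image twist_E)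

lemma subgroup_H2: "subgroup H2 SL2"
proof -
  have "group_hom SL2 SL2 twist"
    using group_SL2 twist_iso by (simp add: group_hom_def group_hom_axioms_def iso_def)
  then show ?thesis unfolding H2_def by (rule group_hom.subgroup_img_is_subgroup[OF _ subgroup_H1])
qed

lemma proj_H2: "projective_image H2 = (`) twist ` projective_image H1"
  unfolding H2_def projective_image_def image_image twist_proj ..

lemma subgroup_projective_image:
  "subgroup (H :: ('k ^ 2 ^ 2) set) SL2 \<Longrightarrow> subgroup (projective_image H) PSL2"
  unfolding projective_image_def by (rule group_hom.subgroup_img_is_subgroup[OF proj_group_hom])

lemma conjugate_projective_image:
  "K \<subseteq> carrier SL2 \<Longrightarrow> conjugate_in SL2 K (L :: ('k ^ 2 ^ 2) set) \<Longrightarrow>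
     conjugate_in PSL2 (projective_image K) (projective_image L)"
  unfolding projective_image_def by (rule conjugate_in_image[OF proj_group_hom])

lemma PSL2_conj:
  assumes "qnorm q = 1" "qnorm x = 1"
  shows "proj (E q) \<otimes>\<^bsub>PSL2\<^esub> proj (E x) \<otimes>\<^bsub>PSL2\<^esub> inv\<^bsub>PSL2\<^esub> proj (E q) = proj (E (nconj q x))"
proof -
  interpret ph: group_hom "SL2 :: ('k ^ 2 ^ 2) monoid" PSL2 proj by (rule proj_group_hom)
  have "E q \<in> carrier SL2" "E x \<in> carrier SL2" using assms by (auto simp: carrier_SL2)
  then show ?thesis by (simp add: SL2_conj[OF assms(1), symmetric])
qed

text \<open>A conjugating \<open>q\<close> would make \<open>qinv gg * q\<close> normalize
  \<open>icos\<close>, signs being absorbed because \<open>- 1\<close> lies in it. Its norm is 1/2,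
  a nonsquare.\<close>

lemma not_conjugate_PSL2: "\<not> conjugate_in PSL2 (projective_image H1) (projective_image H2)"
proof
  assume "conjugate_in PSL2 (projective_image H1) (projective_image H2)"
  then obtain q where q: "qnorm q = 1" and eq: "projective_image H2 =
     (\<lambda>h. proj (E q) \<otimes>\<^bsub>PSL2\<^esub> h \<otimes>\<^bsub>PSL2\<^esub> inv\<^bsub>PSL2\<^esub> proj (E q)) ` projective_image H1"
    unfolding conjugate_in_def carrier_PSL2 carrier_SL2 by blast
  have mem: "nconj (qinv gg * q) h \<in> icos" if h: "h \<in> icos" for h
  proof -
    have "proj (E h) \<in> projective_image H1"
      using h by (simp add: projective_image_def H1_def)
    then have "proj (E (nconj q h)) \<in> projective_image H2"
      unfolding eq by (rule rev_image_eqI) (rule PSL2_conj[OF q icos_closed(5)[OF h], symmetric])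
    then obtain h' where h': "h' \<in> icos" "proj (E (nconj q h)) = proj (E (nconj gg h'))"
      unfolding H2_eq projective_image_def by blast
    have "nconj q h = nconj gg h' \<or> nconj q h = nconj gg (- h')"
      using h'(2) unfolding proj_E_eq nconj_uminus .
    then obtain h'' where "h'' \<in> icos" "nconj q h = nconj gg h''" using h'(1) icos_closed(4) by blast
    then show ?thesis by (simp only: nconj_mult_left nconj_nconj_qinv(2)[OF gg0])
  qed
  have "qnorm (qinv gg * q) \<noteq> s * s" for s
  proof
    assume s: "qnorm (qinv gg * q) = s * s"
    have "qnorm gg * qnorm (qinv gg) = 1" using arg_cong[OF qinv(1)[OF gg0], of qnorm] by (simp only: qnorm_mult qnorm_simps)
    then have "2 * (s * s) = 1" using s q by (simp add: norm_gg)
    then show False using not_half_norm by blast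
  qed
  from icos_normalizer_norm[OF this mem] show False .
qed

text \<open>
  Both \<open>gg\<close> and the normalizer \<open>n\<close> of \<open>K\<close> have nonsquare norm, so \<open>gg * n\<close> can be rescaled to
  norm 1; conjugation by the rescaled element acts on \<open>K\<close> like \<open>twist\<close>.
\<close>

lemma solvable_conjugate_twist:
  assumes K: "subgroup K SL2" "K \<subseteq> H1"
    and sol: "solvable (PSL2\<lparr>carrier := projective_image K\<rparr>)"
  shows "conjugate_in SL2 K (twist ` K)"
proof -
  define Q where "Q = {q. E q \<in> K}"
  have KQ: "K = E ` Q" unfolding Q_def using E_surj by (auto simp: image_iff) metis
  interpret K: subgroup K SL2 by (rule K(1))
  have Qi: "Q \<subseteq> icos" using K(2) unfolding Q_def H1_def by (auto simp: E_inj)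
  have Q1: "1 \<in> Q" using K.one_closed by (simp add: Q_def SL2_one)
  have Qm: "x * y \<in> Q" if "x \<in> Q" "y \<in> Q" for x y
    using K.m_closed[of "E x" "E y"] that by (simp add: Q_def SL2_mult)
  have Qn: "qnorm x = 1" if "x \<in> Q" for x using Qi icos_closed(5) that by blast
  have Qc: "qcnj x \<in> Q" if "x \<in> Q" for x
    using K.m_inv_closed[of "E x"] that Qn[OF that] by (simp add: Q_def SL2_inv)
  have pm: "proj (E x) \<otimes>\<^bsub>PSL2\<^esub> proj (E y) = proj (E (x * y))" if "qnorm x = 1" "qnorm y = 1" for x y
    using hom_mult[OF proj_hom, of "E x" "E y"] that by (simp add: SL2_mult carrier_SL2)
  let ?P = "PSL2\<lparr>carrier := projective_image K\<rparr>"
  have subP: "subgroup (projective_image K) PSL2" by (rule subgroup_projective_image[OF K(1)])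
  interpret P: group ?P by (rule group.subgroup_imp_group[OF group_PSL2 subP])
  have oneP: "\<one>\<^bsub>PSL2\<^esub> = proj (E 1)"
    unfolding SL2_one[symmetric] by (rule group_hom.hom_one[OF proj_group_hom, symmetric])
  show ?thesis
  proof (cases "Q \<subseteq> {1, - 1}")
    case True
    have "twist (E x) = E x" if "x \<in> {1, - 1}" for x
    proof -
      have "nconj gg 1 = 1" by (rule nconj_eqI[OF gg0]) simp
      then show ?thesis using that by (auto simp: twist_E nconj_uminus)
    qed
    then have tw: "twist M = M" if "M \<in> K" for M using True that unfolding KQ by blast
    interpret S: group "SL2 :: ('k ^ 2 ^ 2) monoid" by (rule group_SL2)
    have "twist ` K = (\<lambda>h. \<one>\<^bsub>SL2\<^esub> \<otimes>\<^bsub>SL2\<^esub> h \<otimes>\<^bsub>SL2\<^esub> inv\<^bsub>SL2\<^esub> \<one>\<^bsub>SL2\<^esub>) ` K"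
      by (rule image_cong[OF refl]) (simp add: tw)
    then show ?thesis unfolding conjugate_in_def by (rule bexI) (rule S.one_closed)
  next
    case False
    then obtain x0 where x0: "x0 \<in> Q" "x0 \<noteq> 1" "x0 \<noteq> - 1" by blast
    have "proj (E x0) \<noteq> proj (E 1)" using x0 by (simp add: proj_E_eq)
    moreover have "proj (E x0) \<in> carrier ?P" using x0(1) by (auto simp: projective_image_def KQ)
    ultimately have "carrier ?P \<noteq> {\<one>\<^bsub>?P\<^esub>}" by (auto simp: oneP)
    from P.solvable_abelian_normal[OF sol this] obtain L where
      L: "L \<lhd> ?P" "L \<noteq> {\<one>\<^bsub>?P\<^esub>}" and comm: "\<And>x y. x \<in> L \<Longrightarrow> y \<in> L \<Longrightarrow> x \<otimes>\<^bsub>PSL2\<^esub> y = y \<otimes>\<^bsub>PSL2\<^esub> x"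
      by auto
    interpret L: normal L ?P by (rule L(1))
    have Lsub: "L \<subseteq> projective_image K" using L.subset by simp
    \<comment> \<open>The preimage in \<open>Q\<close> of the abelian \<open>L\<close>: two of its
      elements commute only up to sign.\<close>
    define M where "M = {x \<in> Q. proj (E x) \<in> L}"
    have "\<exists>a\<in>M. a \<noteq> 1 \<and> a \<noteq> - 1"
    proof -
      have "\<one>\<^bsub>PSL2\<^esub> \<in> L" using L.one_closed by simp
      then obtain U where U: "U \<in> L" "U \<noteq> proj (E 1)" using L(2) by (auto simp: oneP)
      then obtain a where a: "a \<in> Q" "U = proj (E a)" using Lsub unfolding projective_image_def KQ by blast
      then show ?thesis using U by (intro bexI[of _ a]) (auto simp: M_def proj_E_eq)
    qed
    then obtain a where a: "a \<in> M" "a \<noteq> 1" "a \<noteq> - 1" by blast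
    have MQ: "M \<subseteq> Q" by (auto simp: M_def)
    have Mconj: "conj_by k x \<in> M" if k: "k \<in> Q" and x: "x \<in> M" for k x
    proof -
      have kP: "proj (E k) \<in> projective_image K" using k by (auto simp: projective_image_def KQ)
      have "proj (E k) \<otimes>\<^bsub>PSL2\<^esub> proj (E x) \<otimes>\<^bsub>PSL2\<^esub> inv\<^bsub>PSL2\<^esub> proj (E k) \<in> L"
        using L.inv_op_closed2[of "proj (E k)" "proj (E x)"] kP x
        by (simp add: M_def group.m_inv_consistent[OF group_PSL2 subP])
      then have "proj (E (conj_by k x)) \<in> L"
        using PSL2_conj[OF Qn Qn, of k x] k x MQ by (simp add: nconj_unit Qn subsetD)
      moreover have "conj_by k x \<in> Q" unfolding conj_by_def using k x MQ Qm Qc by blast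
      ultimately show ?thesis by (simp add: M_def)
    qed
    have Mcomm: "x * y = y * x \<or> x * y = - (y * x)" if "x \<in> M" "y \<in> M" for x y
      using comm[of "proj (E x)" "proj (E y)"] that Qn by (simp add: M_def pm proj_E_eq)
    obtain n where n: "good_normalizer Q n"
      using icos_solvable_normalizer[OF Qi Q1 Qm Qc MQ Mconj a Mcomm] by blast
    then have ns: "\<And>s. qnorm n \<noteq> s * s" and nQ: "\<And>k. k \<in> Q \<Longrightarrow> nconj n k \<in> Q"
      by (auto simp: good_normalizer_def)
    have n0: "qnorm n \<noteq> 0" using ns[of 0] by simp
    have "inj E" by (simp add: inj_def E_inj)
    then have "finite (UNIV :: 'k quat set)" by (rule inj_on_finite[where B = UNIV]) simp_all
    then have finQ: "finite Q" by (rule finite_subset[rotated]) simp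
    have "inj_on (nconj n) Q" by (rule inj_on_inverseI[where g = "nconj (qinv n)"]) (rule nconj_nconj_qinv(2)[OF n0])
    \<comment> \<open>Finiteness upgrades mapping \<open>Q\<close> into itself to mapping it onto
      itself.\<close>
    then have nQ: "nconj n ` Q = Q" using nQ finQ by (intro endo_inj_surj) auto
    obtain s where s: "qnorm gg * qnorm n = s * s"
      using nonsquares_mult[of "qnorm gg" "qnorm n"] ns nonsq(1) by (metis norm_gg)
    have s0: "s \<noteq> 0" using s n0 gg0 by auto
    define q where "q = scalar (1 / s) * (gg * n)"
    have "qnorm q = (1 / s) * (1 / s) * (s * s)"
      by (simp only: q_def qnorm_mult[of "scalar (1 / s)"] qnorm_mult[of gg n] qnorm_simps s)
    then have qn: "qnorm q = 1" using s0 by simp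
    have qc: "nconj q x = nconj gg (nconj n x)" for x
      unfolding q_def nconj_mult_left using s0 by (simp add: nconj_scalar)
    have "twist ` K = E ` nconj gg ` nconj n ` Q" by (simp add: KQ image_image twist_E nQ)
    also have "\<dots> = (\<lambda>h. E q \<otimes>\<^bsub>SL2\<^esub> h \<otimes>\<^bsub>SL2\<^esub> inv\<^bsub>SL2\<^esub> (E q)) ` K"
      by (simp add: KQ image_image SL2_conj[OF qn] qc)
    finally show ?thesis using qn unfolding conjugate_in_def carrier_SL2 by blast
  qed
qed

lemma solvably_equivalent_SL2: "solvably_equivalent SL2 H1 H2"
  unfolding H2_def
proof (rule solvably_equivalent_iso_image[OF group_SL2 twist_iso subgroup_H1])
  fix K assume "K \<in> solvable_subgroups SL2 H1"
  then have K: "subgroup K SL2" "K \<subseteq> H1" "solvable (SL2\<lparr>carrier := K\<rparr>)"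
    unfolding solvable_subgroups_iff[OF group_SL2 subgroup_H1] by auto
  have "solvable (PSL2\<lparr>carrier := projective_image K\<rparr>)"
    unfolding projective_image_def
    by (rule hom_image_solvable_subgroup(2)[OF group_SL2 group_PSL2 proj_hom K(1,3)])
  then show "conjugate_in SL2 K (twist ` K)" using solvable_conjugate_twist K by blast
qed

text \<open>\<open>P\<close> is lifted to its full preimage \<open>K\<close>, contained in
  \<open>H1\<close> because \<open>H1\<close> contains the negatives of its elements. The conjugacy
  found upstairs is then projected.\<close>

lemma solvably_equivalent_PSL2:
  "solvably_equivalent PSL2 (projective_image H1) (projective_image H2)"
  unfolding proj_H2
proof (rule solvably_equivalent_iso_image[OF group_PSL2 ptwist_iso subgroup_projective_image[OF subgroup_H1]])
  fix P assume "P \<in> solvable_subgroups PSL2 (projective_image H1)"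
  then have P: "subgroup P PSL2" "P \<subseteq> projective_image H1" "solvable (PSL2\<lparr>carrier := P\<rparr>)"
    unfolding solvable_subgroups_iff[OF group_PSL2 subgroup_projective_image[OF subgroup_H1]] by auto
  interpret ph: group_hom "SL2 :: ('k ^ 2 ^ 2) monoid" PSL2 proj by (rule proj_group_hom)
  define K where "K = {A \<in> carrier SL2. proj A \<in> P}"
  have K: "subgroup K SL2"
    unfolding K_def
  proof (rule ph.G.subgroupI)
    show "{A \<in> carrier SL2. proj A \<in> P} \<noteq> {}"
      using subgroup.one_closed[OF P(1)] ph.hom_one ph.G.one_closed by fastforce
  qed (use subgroup.m_closed[OF P(1)] subgroup.m_inv_closed[OF P(1)] in auto)
  have KP: "projective_image K = P"
    using P(2) subgroup.subset[OF subgroup_H1] unfolding K_def projective_image_def by blast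
  have KH: "K \<subseteq> H1"
  proof
    fix A assume "A \<in> K"
    then have "proj A \<in> projective_image H1" using P(2) by (auto simp: K_def)
    then obtain h where h: "h \<in> icos" "proj A = proj (E h)" unfolding H1_def projective_image_def by blast
    then have "A = E h \<or> A = E (- h)" by (auto simp: proj_eq E_uminus)
    then show "A \<in> H1" using h(1) icos_closed(4) unfolding H1_def by blast
  qed
  have "conjugate_in SL2 K (twist ` K)" using solvable_conjugate_twist[OF K KH] P(3) KP by simp
  then have "conjugate_in PSL2 (projective_image K) (projective_image (twist ` K))"
    using conjugate_projective_image subgroup.subset[OF K] by blast
  moreover have "projective_image (twist ` K) = (`) twist ` projective_image K"
    unfolding projective_image_def image_image twist_proj ..
  ultimately show "conjugate_in PSL2 P ((`) twist ` P)" by (simp only: KP)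
qed

section \<open>Isomorphism of the projective images with A5\<close>

lemma stab_eq_pair:
  assumes "h \<in> stab f s" "s \<in> alt5"
  shows "stab f s = {h, - h}"
proof (intro equalityI subsetI)
  fix g assume g: "g \<in> stab f s"
  have p: "s permutes {1..5}" using assms(2) by (simp add: alt5_def)
  have "qcnj h * g \<in> stab f (Hilbert_Choice.inv s \<circ> s)" by (intro stab_mult stab_qcnj assms g p)
  then have "qcnj h * g \<in> {1, - 1}" using permutes_inv_o(2)[OF p] stab_id by simp
  moreover have "g = h * (qcnj h * g)" 
    using unit_qcnj(3)[OF stab_qnorm[OF assms(1)]] by simp
  ultimately show "g \<in> {h, - h}" by auto
qed (use assms in auto)

text \<open>The map goes from permutations to PSL2: the fibre over a permutation is a pair
  \<open>{h, - h}\<close>, whose image under \<open>E\<close> is already an element of PSL2.\<close>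

lemma H1_iso_alt5: "PSL2\<lparr>carrier := projective_image H1\<rparr> \<cong> alt_group 5"
proof -
  define psi where "psi s = E ` stab f s" for s
  have carr: "carrier (alt_group 5) = alt5"
    by (auto simp: alt_group_carrier alt5_def)
  have psi: "psi s = proj (E h)" if "h \<in> stab f s" "s \<in> alt5" for h s
    unfolding psi_def stab_eq_pair[OF that] proj_E by simp
  have mem: "\<exists>h. h \<in> stab f s" if "s \<in> alt5" for s using stab_nonempty[OF that] by blast
  have "psi \<in> iso (alt_group 5) (PSL2\<lparr>carrier := projective_image H1\<rparr>)"
  proof (rule isoI)
    show "psi \<in> hom (alt_group 5) (PSL2\<lparr>carrier := projective_image H1\<rparr>)"
    proof (rule homI)
      fix s assume "s \<in> carrier (alt_group 5)"
      then show "psi s \<in> carrier (PSL2\<lparr>carrier := projective_image H1\<rparr>)"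
        using mem psi icosI unfolding carr H1_def projective_image_def by fastforce
    next
      fix s t assume st: "s \<in> carrier (alt_group 5)" "t \<in> carrier (alt_group 5)"
      then obtain g h where gh: "g \<in> stab f s" "h \<in> stab f t" using mem unfolding carr by blast
      have p: "t permutes {1..5}" using st(2) unfolding carr by (simp add: alt5_def)
      have n: "E g \<in> carrier SL2" "E h \<in> carrier SL2" using gh stab_qnorm by (auto simp: carrier_SL2)
      have "psi (s \<circ> t) = proj (E (g * h))"
        using psi[OF stab_mult[OF gh p]] alt5_comp st unfolding carr by blast
      also have "\<dots> = psi s \<otimes>\<^bsub>PSL2\<^esub> psi t"
        using psi[OF gh(1)] psi[OF gh(2)] st hom_mult[OF proj_hom n] unfolding carr by (simp add: SL2_mult)
      finally show "psi (s \<otimes>\<^bsub>alt_group 5\<^esub> t) = psi s \<otimes>\<^bsub>PSL2\<lparr>carrier := projective_image H1\<rparr>\<^esub> psi t"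
        by (simp add: alt_group_mult)
    qed
    show "bij_betw psi (carrier (alt_group 5)) (carrier (PSL2\<lparr>carrier := projective_image H1\<rparr>))"
      unfolding bij_betw_def carr
    proof
      show "inj_on psi alt5"
      proof (rule inj_onI)
        fix s t assume st: "s \<in> alt5" "t \<in> alt5" "psi s = psi t"
        obtain h where h: "h \<in> stab f s" using mem[OF st(1)] by blast
        then have "E h \<in> psi t" using st(3) unfolding psi_def by blast
        then have "h \<in> stab f t" unfolding psi_def by (auto simp: E_inj)
        then show "s = t" using stab_unique[OF h] st(1,2) by (simp add: alt5_def)
      qed
      show "psi ` alt5 = carrier (PSL2\<lparr>carrier := projective_image H1\<rparr>)"
      proof -
        have "psi ` alt5 \<subseteq> projective_image H1"
          using mem psi icosI unfolding H1_def projective_image_def by fastforce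
        moreover have "proj (E h) \<in> psi ` alt5" if "h \<in> icos" for h
          using that psi unfolding icos_def by blast
        ultimately show ?thesis unfolding H1_def projective_image_def by auto
      qed
    qed
  qed
  then have "alt_group 5 \<cong> PSL2\<lparr>carrier := projective_image H1\<rparr>" by (auto simp: is_iso_def)
  then show ?thesis using group.iso_sym[OF alt_group_is_group] by blast
qed

lemma H2_iso_alt5: "PSL2\<lparr>carrier := projective_image H2\<rparr> \<cong> alt_group 5"
proof -
  let ?P = "\<lambda>H. PSL2\<lparr>carrier := projective_image H\<rparr>"
  have "?P H1 \<cong> ?P H2"
    unfolding proj_H2 by (rule subgroup_iso_image[OF group_PSL2 ptwist_iso subgroup_projective_image[OF subgroup_H1]])
  then have "?P H2 \<cong> ?P H1"
    using group.iso_sym[OF group.subgroup_imp_group[OF group_PSL2 subgroup_projective_image[OF subgroup_H1]]] by blast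
  then show ?thesis using H1_iso_alt5 iso_trans by blast
qed

end

theorem theorem3p9:
  fixes p :: nat
  assumes "prime p"
    and "[int p = 29] (mod 120) \<or> [int p = - 29] (mod 120)"
    and "CARD('k::{field,finite}) = p"
  shows "\<exists>H1 H2 :: ('k ^ 2 ^ 2) set.
           subgroup H1 SL2 \<and> subgroup H2 SL2 \<and>
           \<not> conjugate_in SL2 H1 H2 \<and> solvably_equivalent SL2 H1 H2 \<and>
           subgroup (projective_image H1) PSL2 \<and> subgroup (projective_image H2) PSL2 \<and>
           \<not> conjugate_in PSL2 (projective_image H1) (projective_image H2) \<and>
           solvably_equivalent PSL2 (projective_image H1) (projective_image H2) \<and>
           PSL2\<lparr>carrier := projective_image H1\<rparr> \<cong> alt_group 5 \<and>
           PSL2\<lparr>carrier := projective_image H2\<rparr> \<cong> alt_group 5"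
proof -
  have "int p mod 120 = 29 \<or> int p mod 120 = 91" using assms(2) by (auto simp: cong_def)
  then have "int (p mod 120) = 29 \<or> int (p mod 120) = 91" by (simp only: zmod_int of_nat_numeral)
  then have "p mod 120 \<in> {29, 91}" by simp
  from quadratic_residues_120[OF assms(1,3) this] obtain f :: 'k where f: "f * f = f + 1"
    and ns: "\<And>s. s * s \<notin> {2, 3, f + 2, 3 - f}" and two: "(2::'k) \<noteq> 0" by blast
  have ns: "s * s \<noteq> 2" "s * s \<noteq> 3" "s * s \<noteq> f + 2" "s * s \<noteq> 3 - f" for s using ns[of s] by simp_all
  have "\<exists>al be :: 'k. be * be = - 1 - al * al"
  proof (cases "\<exists>s::'k. - 1 = s * s")
    case True
    then obtain s :: 'k where "s * s = - 1" by metis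
    then show ?thesis by (intro exI[of _ 0] exI[of _ s]) simp
  next
    case False
    \<comment> \<open>When \<open>- 1\<close> is a nonsquare, so is 2, and their product
      \<open>- 2 = - 1 - 1 * 1\<close> is a square.\<close>
    then obtain s :: 'k where "- 1 * 2 = s * s" using nonsquares_mult_square[of "- 1 :: 'k" 2] ns(1) by metis
    then show ?thesis by (intro exI[of _ 1] exI[of _ s]) simp
  qed
  then obtain al be :: 'k where ab: "be * be = - 1 - al * al" by blast
  interpret icosahedral_matrices f al be
    by unfold_locales (rule f ns two ab | (rule nonsquares_mult_square; simp))+
  have "\<not> conjugate_in SL2 H1 H2"
    using conjugate_projective_image[OF subgroup.subset[OF subgroup_H1]] not_conjugate_PSL2 by blast
  then show ?thesis
    using subgroup_H1 subgroup_H2 subgroup_projective_image not_conjugate_PSL2 H1_iso_alt5 H2_iso_alt5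
      solvably_equivalent_SL2 solvably_equivalent_PSL2 by blast
qed

end
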